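(* The following are equivalent: (i) Every output trajectory $y(t)$ of $\Sigma\times\Gamma$ converges, as $t\to\infty$, to a point in the set $\operatorname{im}(\mathbb{I}_r)$. (ii) None of the eigenvectors of $M_u^{-1}\tilde{\mathbb{L}}_u$ is contained in the intersection of the kernel of $\mathbb{L}_i^i$ and the kernel of $R_u$, i.e. for each $\mu\in\sigma(M_u^{-1}\tilde{\mathbb{L}}_u)$: $$\ker(M_u^{-1}\tilde{\mathbb{L}}_u-\mu I)\cap\ker\begin{pmatrix}\mathbb{L}_i^i\\ R_u\end{pmatrix}=\{0\}.$$ (iii) Every eigenvector of $M^{-1}\mathbb{L}$ in the kernel of $R$ has at least one nonzero value in an entry that corresponds to a damped node, i.e. for each $\mu\in\sigma(M^{-1}\mathbb{L})$: $$\ker(M^{-1}\mathbb{L}-\mu I)\cap\ker(R)\cap\operatorname{im}\begin{pmatrix}0\\ I_{n_ur}\end{pmatrix}=\{0\}.$$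
   Context: Let $r,n,m$ be positive integers and let $\mathcal G=(V,E)$ be an undirected connected graph with $n$ nodes and $m$ edges; each edge is given an arbitrary orientation and $B\in\mathbb{R}^{n\times m}$ is the resulting incidence matrix. Put $\mathbb{B}=B\otimes I_r$ and $\mathbb{I}_r=\mathbf 1_n\otimes I_r$ ($\mathbf 1_n$ the all-ones vector). For each node $i$ let $M_i\in\mathbb{R}^{r\times r}$ be symmetric positive definite and $R_i\in\mathbb{R}^{r\times r}$ symmetric positive semidefinite; for each edge $k$ let $W_k\in\mathbb{R}^{r\times r}$ be symmetric positive definite. Put $M=\operatorname{diag}(M_1,\dots,M_n)$, $R=\operatorname{diag}(R_1,\dots,R_n)$, $W=\operatorname{diag}(W_1,\dots,W_m)$ (block diagonal). A node $i$ is damped if $R_i\succ0$ and (partially) undamped if $R_i$ is singular (possibly $R_i=0$). $V$ is the disjoint union of the set $V_d$ of damped nodes and the set $V_u$ of (partially) undamped nodes, with cardinalities $n_d\ge1$ and $n_u\ge1$. Let $v\in\mathbb{R}^{rn}$ be constant. The system $\Sigma\times\Gamma$ with state $\operatorname{col}(p,q)$, $p\in\mathbb{R}^{rn}$, $q\in\mathbb{R}^{rm}$, and output $y$, is $$\dot p=-RM^{-1}p-\mathbb{B}Wq+v,\qquad \dot q=\mathbb{B}^TM^{-1}p,\qquad y=M^{-1}p .$$ Decomposition. Order the nodes with damped nodes first, so $M=\operatorname{diag}(M_d,M_u)$, $R=\operatorname{diag}(R_d,R_u)$. Order the edges as: $E^d$ (edges between two damped nodes), $E^i$ (edges between a damped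 and a (partially) undamped node), $E^u$ (edges between two (partially) undamped nodes); correspondingly $W=\operatorname{diag}(W^d,W^i,W^u)$ and $$\mathbb{B}=\begin{pmatrix}\mathbb{B}_d\\ \mathbb{B}_u\end{pmatrix}=\begin{pmatrix}\mathbb{B}_d^d&\mathbb{B}_d^i&0\\0&\mathbb{B}_u^i&\mathbb{B}_u^u\end{pmatrix}.$$ Set $\mathbb{L}_d^d=\mathbb{B}_d^dW^d(\mathbb{B}_d^d)^T$, $\mathbb{L}_u^u=\mathbb{B}_u^uW^u(\mathbb{B}_u^u)^T$, $\mathbb{L}_d^i=\mathbb{B}_d^iW^i(\mathbb{B}_d^i)^T$, $\mathbb{L}_u^i=\mathbb{B}_u^iW^i(\mathbb{B}_u^i)^T$, $\mathbb{L}_i^i=\mathbb{B}_d^iW^i(\mathbb{B}_u^i)^T$, so the total Laplacian is $$\mathbb{L}=\mathbb{B}W\mathbb{B}^T=\begin{pmatrix}\mathbb{L}_d^d+\mathbb{L}_d^i&\mathbb{L}_i^i\\(\mathbb{L}_i^i)^T&\mathbb{L}_u^u+\mathbb{L}_u^i\end{pmatrix}.$$ The Kron-reduced Laplacian is $\tilde{\mathbb{L}}_u=(\mathbb{L}_u^u+\mathbb{L}_u^i)-(\mathbb{L}_i^i)^T(\mathbb{L}_d^d+\mathbb{L}_d^i)^{-1}\mathbb{L}_i^i$. $\sigma(\cdot)$ denotes the spectrum. *)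

theory Defs
  imports "HOL-Analysis.Analysis"
begin

text \<open>
  Sizes are finite types: \<open>'r\<close> for the dimension $r$, \<open>'e\<close> for the $m$ edges, \<open>'d\<close> and \<open>'u\<close> for the
  damped and the (partially) undamped nodes. The node type is \<open>'d + 'u\<close>, which is the ordering
  ``damped nodes first''; as types are nonempty, $n_d, n_u \geq 1$ holds. The space
  $\mathbb{R}^{rn}$ is \<open>real ^ ('n \<times> 'r)\<close>, the pair \<open>(i, a)\<close> being entry \<open>a\<close> of node \<open>i\<close>.
\<close>

section \<open>Matrices\<close>

definition posdef :: "real^'r^'r \<Rightarrow> bool" where
  "posdef A \<longleftrightarrow> transpose A = A \<and> (\<forall>x. x \<noteq> 0 \<longrightarrow> 0 < x \<bullet> (A *v x))"

definition possemidef :: "real^'r^'r \<Rightarrow> bool" where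
  "possemidef A \<longleftrightarrow> transpose A = A \<and> (\<forall>x. 0 \<le> x \<bullet> (A *v x))"

definition kron :: "'a::times^'c^'b \<Rightarrow> 'a^'s^'q \<Rightarrow> 'a^('c \<times> 's)^('b \<times> 'q)" where
  "kron A C = (\<chi> i j. A $ fst i $ fst j * C $ snd i $ snd j)"

definition block_diag :: "('i::finite \<Rightarrow> 'a::zero^'r^'r) \<Rightarrow> 'a^('i \<times> 'r)^('i \<times> 'r)" where
  "block_diag A = (\<chi> i j. if fst i = fst j then A (fst i) $ snd i $ snd j else 0)"

definition vstack ::
  "'a^'c^('d::finite \<times> 'r::finite) \<Rightarrow> 'a^'c^('u::finite \<times> 'r) \<Rightarrow> 'a^'c^(('d + 'u) \<times> 'r)" where
  "vstack A C = (\<chi> i. case fst i of Inl k \<Rightarrow> A $ (k, snd i) | Inr k \<Rightarrow> C $ (k, snd i))"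

definition ker :: "'a::semiring_1^'c^'b \<Rightarrow> ('a^'c) set" where
  "ker A = {x. A *v x = 0}"

definition im :: "'a::semiring_1^'c^'b \<Rightarrow> ('a^'b) set" where
  "im A = range ((*v) A)"

text \<open>
  The spectrum of a real matrix is taken in $\mathbb{C}$, and eigenvectors are complex vectors;
  real matrices act on these through \<open>cmat\<close>.
\<close>

definition cmat :: "real^'c^'b \<Rightarrow> complex^'c^'b" where
  "cmat = map_matrix complex_of_real"

definition spectrum :: "real^'b^'b \<Rightarrow> complex set" where
  "spectrum A = {\<mu>. \<exists>x. x \<noteq> 0 \<and> cmat A *v x = \<mu> *s x}"


section \<open>The graph\<close>

text \<open>
  An oriented simple graph: the edges are the distinct two-element sets \<open>{tail k, head k}\<close>.
\<close>

definition oriented_graph :: "('e \<Rightarrow> 'n) \<Rightarrow> ('e \<Rightarrow> 'n) \<Rightarrow> bool" where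
  "oriented_graph tail head \<longleftrightarrow>
     (\<forall>k. tail k \<noteq> head k) \<and> inj (\<lambda>k. {tail k, head k})"

definition connected_graph :: "('e \<Rightarrow> 'n) \<Rightarrow> ('e \<Rightarrow> 'n) \<Rightarrow> bool" where
  "connected_graph tail head \<longleftrightarrow>
     (\<forall>i j. (i, j) \<in> (\<Union>k. {(tail k, head k), (head k, tail k)})\<^sup>*)"

definition incidence :: "('e::finite \<Rightarrow> 'n::finite) \<Rightarrow> ('e \<Rightarrow> 'n) \<Rightarrow> real^'e^'n" where
  "incidence tail head =
     (\<chi> i k. if i = head k then 1 else if i = tail k then -1 else 0)"

definition BB :: "('e::finite \<Rightarrow> 'n::finite) \<Rightarrow> ('e \<Rightarrow> 'n) \<Rightarrow> real^('e \<times> 'r::finite)^('n \<times> 'r)" where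
  "BB tail head = kron (incidence tail head) (mat 1)"

definition II :: "real^(1 \<times> 'r::finite)^('n::finite \<times> 'r)" where
  "II = kron (columnvector (vec 1)) (mat 1)"

definition edges_d :: "('e \<Rightarrow> 'd + 'u) \<Rightarrow> ('e \<Rightarrow> 'd + 'u) \<Rightarrow> 'e set" where
  "edges_d tail head = {k. tail k \<in> range Inl \<and> head k \<in> range Inl}"

definition edges_u :: "('e \<Rightarrow> 'd + 'u) \<Rightarrow> ('e \<Rightarrow> 'd + 'u) \<Rightarrow> 'e set" where
  "edges_u tail head = {k. tail k \<in> range Inr \<and> head k \<in> range Inr}"

definition edges_i :: "('e \<Rightarrow> 'd + 'u) \<Rightarrow> ('e \<Rightarrow> 'd + 'u) \<Rightarrow> 'e set" where
  "edges_i tail head = {k. tail k \<in> range Inl \<and> head k \<in> range Inr \<or>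
                           tail k \<in> range Inr \<and> head k \<in> range Inl}"


section \<open>The decomposition\<close>

text \<open>
  Each of the three classes of edges may be empty, unlike a type. So a block belonging to a class
  \<open>S\<close> keeps all edges as column index and is zero outside \<open>S\<close>; products such as
  $\mathbb{B}_d^d W^d (\mathbb{B}_d^d)^T$, in which edge indices are summed over, are not affected.
\<close>

definition block_u ::
  "('d + 'u::finite \<Rightarrow> real^'r^'r) \<Rightarrow> real^('u \<times> 'r)^('u \<times> 'r)" where
  "block_u A = block_diag (\<lambda>i. A (Inr i))"

definition BB_d ::
  "'e::finite set \<Rightarrow> ('e \<Rightarrow> 'd::finite + 'u::finite) \<Rightarrow> ('e \<Rightarrow> 'd + 'u)
   \<Rightarrow> real^('e \<times> 'r::finite)^('d \<times> 'r)" where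
  "BB_d S tail head =
     (\<chi> i k. if fst k \<in> S then BB tail head $ (Inl (fst i), snd i) $ k else 0)"

definition BB_u ::
  "'e::finite set \<Rightarrow> ('e \<Rightarrow> 'd::finite + 'u::finite) \<Rightarrow> ('e \<Rightarrow> 'd + 'u)
   \<Rightarrow> real^('e \<times> 'r::finite)^('u \<times> 'r)" where
  "BB_u S tail head =
     (\<chi> i k. if fst k \<in> S then BB tail head $ (Inr (fst i), snd i) $ k else 0)"

definition W_on :: "'e::finite set \<Rightarrow> ('e \<Rightarrow> real^'r^'r) \<Rightarrow> real^('e \<times> 'r)^('e \<times> 'r)" where
  "W_on S W = block_diag (\<lambda>k. if k \<in> S then W k else 0)"

context
  fixes tail head :: "'e::finite \<Rightarrow> 'd::finite + 'u::finite"
    and W :: "'e \<Rightarrow> real^'r::finite^'r"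
begin

definition L_dd :: "real^('d \<times> 'r)^('d \<times> 'r)" where
  "L_dd = BB_d (edges_d tail head) tail head ** W_on (edges_d tail head) W
          ** transpose (BB_d (edges_d tail head) tail head)"

definition L_uu :: "real^('u \<times> 'r)^('u \<times> 'r)" where
  "L_uu = BB_u (edges_u tail head) tail head ** W_on (edges_u tail head) W
          ** transpose (BB_u (edges_u tail head) tail head)"

definition L_di :: "real^('d \<times> 'r)^('d \<times> 'r)" where
  "L_di = BB_d (edges_i tail head) tail head ** W_on (edges_i tail head) W
          ** transpose (BB_d (edges_i tail head) tail head)"

definition L_ui :: "real^('u \<times> 'r)^('u \<times> 'r)" where
  "L_ui = BB_u (edges_i tail head) tail head ** W_on (edges_i tail head) W
          ** transpose (BB_u (edges_i tail head) tail head)"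

definition L_ii :: "real^('u \<times> 'r)^('d \<times> 'r)" where
  "L_ii = BB_d (edges_i tail head) tail head ** W_on (edges_i tail head) W
          ** transpose (BB_u (edges_i tail head) tail head)"

definition L_kron :: "real^('u \<times> 'r)^('u \<times> 'r)" where
  "L_kron = (L_uu + L_ui) - transpose L_ii ** matrix_inv (L_dd + L_di) ** L_ii"

end

definition laplacian ::
  "('e::finite \<Rightarrow> 'n::finite) \<Rightarrow> ('e \<Rightarrow> 'n) \<Rightarrow> ('e \<Rightarrow> real^'r^'r)
   \<Rightarrow> real^('n \<times> 'r)^('n \<times> 'r)" where
  "laplacian tail head W = BB tail head ** block_diag W ** transpose (BB tail head)"


section \<open>The system\<close>

definition trajectory ::
  "('e::finite \<Rightarrow> 'n::finite) \<Rightarrow> ('e \<Rightarrow> 'n) \<Rightarrow> ('n \<Rightarrow> real^'r^'r)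
   \<Rightarrow> ('n \<Rightarrow> real^'r^'r) \<Rightarrow> ('e \<Rightarrow> real^'r^'r) \<Rightarrow> real^('n \<times> 'r)
   \<Rightarrow> (real \<Rightarrow> real^('n \<times> 'r)) \<Rightarrow> (real \<Rightarrow> real^('e \<times> 'r)) \<Rightarrow> bool" where
  "trajectory tail head M R W v p q \<longleftrightarrow>
     (\<forall>t\<ge>0.
        (p has_vector_derivative
           - (block_diag R ** matrix_inv (block_diag M) *v p t)
           - (BB tail head ** block_diag W *v q t) + v) (at t within {0..}) \<and>
        (q has_vector_derivative
           transpose (BB tail head) ** matrix_inv (block_diag M) *v p t) (at t within {0..}))"

definition system_output ::
  "('n::finite \<Rightarrow> real^'r^'r) \<Rightarrow> (real \<Rightarrow> real^('n \<times> 'r)) \<Rightarrow> real \<Rightarrow> real^('n \<times> 'r)" where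
  "system_output M p t = matrix_inv (block_diag M) *v p t"

end

theory Submission
  imports Defs
begin

text \<open>
  All three conditions are reduced to one statement about real vectors: no \<open>x \<noteq> 0\<close> satisfies
  \<open>\<L> x = \<mu> M x\<close> and \<open>R x = 0\<close> for a real \<open>\<mu>\<close>, where \<open>\<L>\<close> is the total Laplacian.

  The spectral conditions are algebra. As \<open>M\<close> is positive definite and the Laplacians are symmetric,
  the generalised eigenvalues are real and the real and imaginary parts of a complex eigenvector are
  again eigenvectors (\<open>no_eigenvector_in_kernel_iff_real\<close>). A vector in the kernel of \<open>R\<close> vanishes at
  the damped nodes, so it is \<open>(0, z)\<close>, and the Laplacian maps it to
  \<open>(L_ii z, (L_uu + L_ui) z)\<close>; thus it satisfies the eigenvalue equation iff
  \<open>L_ii z = 0\<close> and \<open>(L_uu + L_ui) z = \<mu> M_u z\<close>. On the kernel of \<open>L_ii\<close> the correction term of the Kron reduction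
  vanishes, whence the condition on the reduced Laplacian (\<open>undamped_eigenvectors_iff\<close>).

  For the dynamics, there is an equilibrium \<open>(M y0, q0)\<close> with \<open>y0\<close> in the image of \<open>II\<close>
  (\<open>equilibrium_exists\<close>), and by linearity only deviations from it matter. If a forbidden eigenvector
  \<open>x\<close> exists, then \<open>\<mu> > 0\<close> because connectedness forces a kernel vector of the Laplacian to be
  constant over the nodes, and \<open>y0 + cos (sqrt \<mu> t) x\<close> is an output that does not converge. Conversely
  the energy of the deviation decreases at rate \<open>y \<bullet> R y\<close>, so trajectories are bounded and
  \<open>R y \<rightarrow> 0\<close>. The equation \<open>M y'' = - R y' - \<L> y\<close> then propagates this to
  \<open>R K^k y \<rightarrow> 0\<close> for every \<open>k\<close>, where \<open>K = M^(-1) \<L>\<close>: derivatives of a convergent function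
  with bounded further derivatives tend to zero. Every limit point of \<open>y\<close> therefore lies in a
  \<open>K\<close>-invariant subspace of the kernel of \<open>R\<close>. A nonzero invariant subspace would contain an
  eigenvector by the Rayleigh quotient, so the limit point is \<open>0\<close> and \<open>y \<rightarrow> 0\<close>
  (\<open>damped_output_tendsto_zero\<close>).
\<close>

section \<open>Quadratic forms\<close>

text \<open>The first-order optimality condition behind both the kernel of a semidefinite form and the
  maximiser of the Rayleigh quotient: a quadratic without constant term changes sign at \<open>0\<close>
  unless its linear term vanishes.\<close>

lemma quadratic_nonneg_imp_linear_zero:
  fixes a c :: real
  assumes "\<And>t. 0 \<le> 2 * t * a + t\<^sup>2 * c"
  shows "a = 0"
proof (rule ccontr)
  assume "a \<noteq> 0"
  define d where "d = \<bar>c\<bar> + 1"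
  have d: "d > 0" "c < d" by (auto simp: d_def)
  \<comment> \<open>the test point \<open>t = - a / d\<close> is small enough for the linear term to dominate\<close>
  have "2 * (- a / d) * a + (- a / d)\<^sup>2 * c = (a\<^sup>2 / d) * (c / d - 2)"
    using d by (simp add: field_simps power2_eq_square)
  also have "\<dots> < 0"
    using d \<open>a \<noteq> 0\<close> by (intro mult_pos_neg) (auto simp: field_simps)
  finally show False using assms[of "- a / d"] by simp
qed

lemma inner_symmetric_matrix:
  fixes A :: "real^'n^'n"
  assumes "transpose A = A"
  shows "x \<bullet> (A *v y) = y \<bullet> (A *v x)"
  using assms dot_lmul_matrix[of x A y] transpose_matrix_vector[of A x]
  by (simp add: inner_commute)

lemma form_add_scaled:
  fixes A :: "real^'n^'n"
  assumes "transpose A = A"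
  shows "(x + t *\<^sub>R h) \<bullet> (A *v (x + t *\<^sub>R h)) =
    x \<bullet> (A *v x) + 2 * t * (h \<bullet> (A *v x)) + t\<^sup>2 * (h \<bullet> (A *v h))"
  using inner_symmetric_matrix[OF assms, of x h]
  by (simp add: matrix_vector_right_distrib matrix_vector_mult_scaleR inner_add_left inner_add_right
      power2_eq_square algebra_simps)

text \<open>A zero of a semidefinite form is a minimiser, so the form is stationary there in every
  direction, in particular in the direction \<open>A x\<close>.\<close>

lemma possemidef_form_zero:
  assumes "possemidef A" "x \<bullet> (A *v x) = 0"
  shows "A *v x = 0"
proof -
  have "(A *v x) \<bullet> (A *v x) = 0"
  proof (rule quadratic_nonneg_imp_linear_zero)
    fix t
    show "0 \<le> 2 * t * ((A *v x) \<bullet> (A *v x)) + t\<^sup>2 * ((A *v x) \<bullet> (A *v (A *v x)))"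
      using assms form_add_scaled[of A x t "A *v x"]
      unfolding possemidef_def by (metis add_0)
  qed
  then show ?thesis by simp
qed

lemma posdef_imp_possemidef: "posdef A \<Longrightarrow> possemidef A"
  unfolding posdef_def possemidef_def by (metis inner_zero_left less_eq_real_def)

lemma posdef_form_zero: "posdef A \<Longrightarrow> x \<bullet> (A *v x) = 0 \<Longrightarrow> x = 0"
  unfolding posdef_def by force

lemma posdef_inverse:
  assumes "posdef A"
  shows "matrix_inv A ** A = mat 1" "A ** matrix_inv A = mat 1"
proof -
  have "\<forall>x. A *v x = 0 \<longrightarrow> x = 0"
    using assms posdef_form_zero by force
  then have "invertible A"
    unfolding invertible_left_inverse matrix_left_invertible_ker .
  then show "matrix_inv A ** A = mat 1" "A ** matrix_inv A = mat 1"
    unfolding invertible_def matrix_inv_def by (metis (mono_tags, lifting) someI_ex)+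
qed

lemma posdef_inverse_mult:
  assumes "posdef A"
  shows "matrix_inv A *v (A *v x) = x" "A *v (matrix_inv A *v x) = x"
  by (simp_all add: matrix_vector_mul_assoc posdef_inverse[OF assms])

text \<open>The form attains a positive minimum on the unit sphere, which is compact.\<close>

lemma posdef_coercive:
  fixes A :: "real^'n^'n"
  assumes "posdef A"
  obtains c where "c > 0" "\<And>x. c * (norm x)\<^sup>2 \<le> x \<bullet> (A *v x)"
proof -
  have "\<exists>u\<in>sphere 0 1. \<forall>x\<in>sphere 0 1. u \<bullet> (A *v u) \<le> x \<bullet> (A *v x)"
  proof (rule continuous_attains_inf)
    show "sphere (0::real^'n) 1 \<noteq> {}" by simp
  qed (auto intro!: continuous_intros)
  then obtain u where u: "norm u = 1" "\<And>x. norm x = 1 \<Longrightarrow> u \<bullet> (A *v u) \<le> x \<bullet> (A *v x)"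
    by auto
  have "u \<noteq> 0" using u by auto
  then have pos: "0 < u \<bullet> (A *v u)" using assms by (auto simp: posdef_def)
  have "(u \<bullet> (A *v u)) * (norm x)\<^sup>2 \<le> x \<bullet> (A *v x)" for x
  proof (cases "x = 0")
    case False
    then have "u \<bullet> (A *v u) \<le> (x /\<^sub>R norm x) \<bullet> (A *v (x /\<^sub>R norm x))"
      by (intro u) simp
    then show ?thesis using False
      by (simp add: matrix_vector_mult_scaleR power2_eq_square field_simps)
  qed simp
  with pos that show ?thesis by blast
qed

text \<open>A maximiser \<open>u\<close> of the Rayleigh quotient of the pencil \<open>(L, M)\<close> over the subspace is an
  eigenvector: stationarity makes the residual \<open>h = M^(-1) L u - \<mu> u\<close> orthogonal, in the inner product
  given by \<open>M\<close>, to the whole subspace, and invariance puts \<open>h\<close> itself into it. Membership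
  of the preimage of \<open>L y\<close> under \<open>M\<close> expresses invariance under \<open>M^(-1) L\<close>.\<close>

lemma symmetric_eigenvector_in_invariant_subspace:
  fixes L M :: "real^'n^'n"
  assumes M: "posdef M" and L: "transpose L = L"
    and Y: "subspace Y" "x0 \<in> Y" "x0 \<noteq> 0"
    and inv: "\<And>y. y \<in> Y \<Longrightarrow> \<exists>z\<in>Y. M *v z = L *v y"
  obtains x \<mu> where "x \<in> Y" "x \<noteq> 0" "L *v x = \<mu> *\<^sub>R (M *v x)"
proof -
  let ?S = "sphere 0 1 \<inter> Y"
  have Mpos: "0 < x \<bullet> (M *v x)" if "x \<noteq> 0" for x
    using M that by (auto simp: posdef_def)
  have Msym: "transpose M = M" using M by (simp add: posdef_def)
  have "\<exists>u\<in>?S. \<forall>x\<in>?S. (x \<bullet> (L *v x)) / (x \<bullet> (M *v x)) \<le> (u \<bullet> (L *v u)) / (u \<bullet> (M *v u))"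
  proof (rule continuous_attains_sup)
    show "compact ?S"
      by (intro compact_Int_closed compact_sphere closed_subspace Y)
    have "x0 /\<^sub>R norm x0 \<in> ?S" using Y by (auto simp: subspace_scale)
    then show "?S \<noteq> {}" by blast
    have "x \<bullet> (M *v x) \<noteq> 0" if "x \<in> ?S" for x
      using Mpos[of x] that by force
    then show "continuous_on ?S (\<lambda>x. (x \<bullet> (L *v x)) / (x \<bullet> (M *v x)))"
      by (auto intro!: continuous_intros)
  qed
  then obtain u where u: "norm u = 1" "u \<in> Y"
    "\<And>x. norm x = 1 \<Longrightarrow> x \<in> Y \<Longrightarrow> (x \<bullet> (L *v x)) / (x \<bullet> (M *v x)) \<le> (u \<bullet> (L *v u)) / (u \<bullet> (M *v u))"
    by auto
  define \<mu> where "\<mu> = (u \<bullet> (L *v u)) / (u \<bullet> (M *v u))"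
  have "u \<noteq> 0" using u by auto
  have max: "x \<bullet> (L *v x) \<le> \<mu> * (x \<bullet> (M *v x))" if "x \<in> Y" for x
  proof (cases "x = 0")
    case False
    have "((x /\<^sub>R norm x) \<bullet> (L *v (x /\<^sub>R norm x))) / ((x /\<^sub>R norm x) \<bullet> (M *v (x /\<^sub>R norm x))) \<le> \<mu>"
      unfolding \<mu>_def using False that Y by (intro u) (auto simp: subspace_scale)
    then have "(x \<bullet> (L *v x)) / (x \<bullet> (M *v x)) \<le> \<mu>"
      using False by (simp add: matrix_vector_mult_scaleR)
    then show ?thesis using Mpos[OF False] by (simp add: field_simps)
  qed simp
  obtain z where z: "z \<in> Y" "M *v z = L *v u" using inv u by blast
  define h where "h = z - \<mu> *\<^sub>R u"
  have h: "h \<in> Y" using Y z u by (auto simp: h_def intro!: subspace_diff subspace_scale)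
  have Mh: "M *v h = L *v u - \<mu> *\<^sub>R (M *v u)"
    by (simp add: h_def matrix_vector_mult_diff_distrib matrix_vector_mult_scaleR z)
  have "h \<bullet> (M *v h) = 0"
  proof (rule quadratic_nonneg_imp_linear_zero)
    fix t :: real
    \<comment> \<open>maximality at \<open>u - t h\<close>; the constant term vanishes by the choice of \<open>\<mu>\<close>\<close>
    have "u + (- t) *\<^sub>R h \<in> Y" using Y h u by (intro subspace_add subspace_scale) auto
    from max[OF this] have "0 \<le> 2 * t * (h \<bullet> (L *v u) - \<mu> * (h \<bullet> (M *v u)))
        + t\<^sup>2 * (\<mu> * (h \<bullet> (M *v h)) - h \<bullet> (L *v h)) + (\<mu> * (u \<bullet> (M *v u)) - u \<bullet> (L *v u))"
      unfolding form_add_scaled[OF L] form_add_scaled[OF Msym]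
      by (simp add: algebra_simps)
    moreover have "\<mu> * (u \<bullet> (M *v u)) - u \<bullet> (L *v u) = 0"
      using Mpos[OF \<open>u \<noteq> 0\<close>] by (simp add: \<mu>_def)
    ultimately show "0 \<le> 2 * t * (h \<bullet> (M *v h)) + t\<^sup>2 * (\<mu> * (h \<bullet> (M *v h)) - h \<bullet> (L *v h))"
      unfolding Mh inner_diff_right inner_scaleR_right
      by simp
  qed
  then have "h = 0" using M posdef_form_zero by blast
  then have "L *v u = \<mu> *\<^sub>R (M *v u)" using Mh by simp
  with u \<open>u \<noteq> 0\<close> that show ?thesis by blast
qed

lemma weighted_gram_symmetric:
  fixes W :: "real^'m^'m" and B :: "real^'m^'n"
  assumes "transpose W = W"
  shows "transpose (B ** W ** transpose B) = B ** W ** transpose B"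
  by (simp add: matrix_transpose_mul assms matrix_mul_assoc)

section \<open>Limits of functions of time\<close>

text \<open>A form of Barbalat's lemma. Over a step of length \<open>s\<close> the increment of \<open>f\<close> is \<open>s g t\<close> up
  to an error \<open>C s^2\<close>; the increment tends to zero, so \<open>g\<close> is eventually at most about \<open>C s\<close>, for
  each fixed \<open>s > 0\<close>.\<close>

lemma derivative_tendsto_zero:
  fixes f :: "real \<Rightarrow> 'a::real_normed_vector"
  assumes f: "\<And>t. t \<ge> a \<Longrightarrow> (f has_vector_derivative g t) (at t)"
    and g: "\<And>t. t \<ge> a \<Longrightarrow> (g has_vector_derivative h t) (at t)"
    and h: "bounded (h ` {a..})"
    and lim: "(f \<longlongrightarrow> l) at_top"
  shows "(g \<longlongrightarrow> 0) at_top"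
proof -
  obtain C where C: "C > 0" "\<And>t. t \<ge> a \<Longrightarrow> norm (h t) \<le> C"
    using h unfolding bounded_pos by auto
  have g_lip: "norm (g u - g t) \<le> C * norm (u - t)" if "a \<le> t" "t \<le> u" for t u
  proof (rule differentiable_bound[of "{t..u}" g "\<lambda>x s. s *\<^sub>R h x"])
    show "(g has_derivative (\<lambda>s. s *\<^sub>R h x)) (at x within {t..u})" if "x \<in> {t..u}" for x
      using g[of x] that \<open>a \<le> t\<close> has_derivative_at_withinI
      by (auto simp: has_vector_derivative_def)
    show "onorm (\<lambda>s. s *\<^sub>R h x) \<le> C" if "x \<in> {t..u}" for x
      using C(2)[of x] that \<open>a \<le> t\<close>
      by (intro onorm_le) (auto simp: mult.commute[of C] intro!: mult_left_mono)
  qed (use that in auto)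
  have f_lin: "norm (f (t + s) - f t - s *\<^sub>R g t) \<le> C * s * s" if "a \<le> t" "0 \<le> s" for t s
  proof -
    have "norm ((f (t + s) - (t + s) *\<^sub>R g t) - (f t - t *\<^sub>R g t)) \<le> (C * s) * norm ((t + s) - t)"
    proof (rule differentiable_bound[of "{t..t+s}" "\<lambda>x. f x - x *\<^sub>R g t" "\<lambda>x r. r *\<^sub>R (g x - g t)"])
      show "((\<lambda>x. f x - x *\<^sub>R g t) has_derivative (\<lambda>r. r *\<^sub>R (g x - g t))) (at x within {t..t+s})"
        if "x \<in> {t..t+s}" for x
        using f[of x] that \<open>a \<le> t\<close> has_derivative_at_withinI
        by (auto simp: has_vector_derivative_def scaleR_diff_right
            intro!: derivative_eq_intros)
      show "onorm (\<lambda>r. r *\<^sub>R (g x - g t)) \<le> C * s" if "x \<in> {t..t+s}" for x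
      proof (rule onorm_le)
        fix r :: real
        have "norm (g x - g t) \<le> C * norm (x - t)" using g_lip that \<open>a \<le> t\<close> by auto
        also have "\<dots> \<le> C * s" using that C by auto
        finally show "norm (r *\<^sub>R (g x - g t)) \<le> C * s * norm r"
          by (simp add: mult.commute[of "C * s"] mult_left_mono)
      qed
    qed (use that in auto)
    then show ?thesis using that by (simp add: algebra_simps)
  qed
  show ?thesis
  proof (rule tendstoI)
    fix e :: real assume "e > 0"
    define s where "s = e / (2 * C)"
    have s: "s > 0" "C * s = e / 2" using \<open>e > 0\<close> C by (auto simp: s_def)
    have "filterlim (\<lambda>t. t + s) at_top at_top"
      by (rule filterlim_tendsto_add_at_top[OF tendsto_const filterlim_ident, of s, simplified add.commute])
    then have "((\<lambda>t. f (t + s) - f t) \<longlongrightarrow> l - l) at_top"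
      by (intro tendsto_diff lim filterlim_compose[OF lim])
    then have "eventually (\<lambda>t. dist (f (t + s) - f t) 0 < s * e / 2) at_top"
      using tendstoD[of "\<lambda>t. f (t + s) - f t" 0 at_top "s * e / 2"] s \<open>e > 0\<close> by simp
    then show "eventually (\<lambda>t. dist (g t) 0 < e) at_top"
      using eventually_ge_at_top[of a]
    proof eventually_elim
      case (elim t)
      have "s * norm (g t) = norm (s *\<^sub>R g t)" using s by simp
      also have "\<dots> \<le> norm (f (t + s) - f t) + norm (f (t + s) - f t - s *\<^sub>R g t)"
        using norm_triangle_ineq4[of "f (t + s) - f t" "f (t + s) - f t - s *\<^sub>R g t"] by simp
      also have "\<dots> < s * e / 2 + C * s * s"
        using elim by (intro add_less_le_mono f_lin) (use s in auto)
      also have "\<dots> = s * e" using s(2) by (simp add: field_simps)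
      finally show ?case using s by simp
    qed
  qed
qed

text \<open>The mechanism of LaSalle's invariance principle: along any sequence of times tending to
  infinity a bounded curve has a limit point, and by continuity all \<open>f i\<close> vanish there. It transfers convergence to
  zero from \<open>f i\<close> to \<open>g\<close> without any quantitative comparison between them.\<close>

lemma tendsto_zero_via_limit_points:
  fixes y :: "real \<Rightarrow> 'a::euclidean_space"
    and f :: "'i \<Rightarrow> 'a \<Rightarrow> 'b::real_normed_vector" and g :: "'a \<Rightarrow> 'c::real_normed_vector"
  assumes bdd: "bounded (y ` {a..})"
    and f: "\<And>i. continuous_on UNIV (f i)" "\<And>i. ((\<lambda>t. f i (y t)) \<longlongrightarrow> 0) at_top"
    and g: "continuous_on UNIV g"
    and zero: "\<And>z. (\<And>i. f i z = 0) \<Longrightarrow> g z = 0"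
  shows "((\<lambda>t. g (y t)) \<longlongrightarrow> 0) at_top"
proof (rule ccontr)
  assume "\<not> ?thesis"
  then obtain e where e: "e > 0" "\<not> eventually (\<lambda>t. dist (g (y t)) 0 < e) at_top"
    by (auto simp: tendsto_iff)
  have "\<forall>n. \<exists>t. t \<ge> max a (real n) \<and> norm (g (y t)) \<ge> e"
    using e(2) unfolding eventually_at_top_linorder dist_0_norm dist_norm diff_zero
    by (metis not_less)
  then obtain T where T: "\<And>n. T n \<ge> max a (real n)" "\<And>n. norm (g (y (T n))) \<ge> e"
    by metis
  have T_top: "filterlim T at_top sequentially"
    by (rule filterlim_at_top_mono[OF filterlim_real_sequentially]) (use T(1) in auto)
  have "\<forall>n. (y \<circ> T) n \<in> closure (y ` {a..})"
    using T(1) by (auto intro!: subsetD[OF closure_subset])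
  moreover have "compact (closure (y ` {a..}))" using bdd by (simp add: compact_closure)
  ultimately obtain z r where r: "strict_mono r" "((y \<circ> T) \<circ> r) \<longlonglongrightarrow> z"
    unfolding compact_def by metis
  have lim: "(\<lambda>n. \<phi> (y (T (r n)))) \<longlonglongrightarrow> \<phi> z" if "continuous_on UNIV \<phi>" for \<phi> :: "'a \<Rightarrow> 'd::real_normed_vector"
    using continuous_on_tendsto_compose[OF that r(2)] by (simp add: o_def)
  have Tr: "filterlim (\<lambda>n. T (r n)) at_top sequentially"
    using filterlim_compose[OF T_top filterlim_subseq[OF r(1)]] .
  have "f i z = 0" for i
    using LIMSEQ_unique[OF lim[OF f(1)] filterlim_compose[OF f(2) Tr]] .
  then have "g z = 0" using zero by blast
  then have "(\<lambda>n. norm (g (y (T (r n))))) \<longlonglongrightarrow> 0"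
    using tendsto_norm[OF lim[OF g]] by simp
  then have "e \<le> 0" by (rule LIMSEQ_le_const) (use T(2) in auto)
  with e show False by simp
qed

lemma nonincreasing_bounded_below_tendsto:
  fixes f :: "real \<Rightarrow> real"
  assumes "\<And>s t. a \<le> s \<Longrightarrow> s \<le> t \<Longrightarrow> f t \<le> f s" "\<And>t. a \<le> t \<Longrightarrow> b \<le> f t"
  obtains l where "(f \<longlongrightarrow> l) at_top"
proof
  have bdd: "bdd_below (f ` {a..})" using assms(2) by (auto intro!: bdd_belowI2)
  show "(f \<longlongrightarrow> Inf (f ` {a..})) at_top"
  proof (rule order_tendstoI)
    fix c assume "c < Inf (f ` {a..})"
    then have "c < f t" if "t \<ge> a" for t
      using cInf_lower[OF _ bdd, of "f t"] that by force
    then show "eventually (\<lambda>t. c < f t) at_top"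
      by (auto intro: eventually_mono[OF eventually_ge_at_top[of a]])
  next
    fix c assume "Inf (f ` {a..}) < c"
    then obtain s where "s \<ge> a" "f s < c"
      using cInf_lessD[of "f ` {a..}" c] by auto
    then show "eventually (\<lambda>t. f t < c) at_top"
      using assms(1) by (auto intro!: eventually_mono[OF eventually_ge_at_top[of s]] intro: le_less_trans)
  qed
qed

lemma bounded_matrix_image:
  fixes A :: "real^'n^'m"
  assumes "bounded (f ` S)"
  shows "bounded ((\<lambda>t. A *v f t) ` S)"
  using bounded_linear_image[OF assms matrix_vector_mul_bounded_linear[of A]]
  by (simp add: image_image)

lemma bounded_uminus_image:
  fixes f :: "'b \<Rightarrow> 'a::real_normed_vector"
  shows "bounded (f ` S) \<Longrightarrow> bounded ((\<lambda>t. - f t) ` S)"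
  using bounded_uminus[of "f ` S"] by (simp add: image_image)

lemma bounded_inner_image:
  assumes "bounded (f ` S)" "bounded (g ` S)"
  shows "bounded ((\<lambda>t. f t \<bullet> g t) ` S)"
proof -
  obtain C D where "\<And>t. t \<in> S \<Longrightarrow> norm (f t) \<le> C" "\<And>t. t \<in> S \<Longrightarrow> norm (g t) \<le> D"
    using assms unfolding bounded_iff by fastforce
  then have "norm (f t \<bullet> g t) \<le> \<bar>C\<bar> * \<bar>D\<bar>" if "t \<in> S" for t
    using that Cauchy_Schwarz_ineq2[of "f t" "g t"]
    by (smt (verit) mult_mono norm_ge_zero real_norm_def)
  then show ?thesis by (auto simp: bounded_iff)
qed

lemma bounded_if_form_bounded:
  fixes A :: "real^'n^'n"
  assumes "posdef A" "\<And>t. t \<in> S \<Longrightarrow> f t \<bullet> (A *v f t) \<le> C"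
  shows "bounded (f ` S)"
proof -
  obtain c where c: "c > 0" "\<And>x. c * (norm x)\<^sup>2 \<le> x \<bullet> (A *v x)"
    using posdef_coercive[OF assms(1)] by blast
  have "norm (f t) \<le> sqrt (C / c)" if "t \<in> S" for t
  proof (rule real_le_rsqrt)
    show "(norm (f t))\<^sup>2 \<le> C / c"
      using c(1) order_trans[OF c(2)[of "f t"] assms(2)[OF that]] by (simp add: field_simps)
  qed
  then show ?thesis unfolding bounded_iff by auto
qed

lemmas has_vector_derivative_matrix =
  bounded_linear.has_vector_derivative[OF matrix_vector_mul_bounded_linear]

text \<open>Times in steps of the period show that a limit would have to equal every value of the
  function.\<close>

lemma cos_not_convergent:
  fixes \<omega> :: real
  assumes "\<omega> > 0"
  shows "\<not> ((\<lambda>t. cos (\<omega> * t)) \<longlongrightarrow> l) at_top"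
proof
  assume lim: "((\<lambda>t. cos (\<omega> * t)) \<longlongrightarrow> l) at_top"
  have seq: "(\<lambda>n. cos (\<omega> * (real n * (2 * pi / \<omega>) + c))) \<longlonglongrightarrow> l" for c
  proof (rule filterlim_compose[OF lim])
    have "filterlim (\<lambda>n. c + real n * (2 * pi / \<omega>)) at_top sequentially"
      using assms
      by (intro filterlim_tendsto_add_at_top[OF tendsto_const] filterlim_at_top_mult_tendsto_pos[OF tendsto_const]
          filterlim_real_sequentially) auto
    then show "filterlim (\<lambda>n. real n * (2 * pi / \<omega>) + c) at_top sequentially"
      by (simp add: add.commute)
  qed
  have "\<omega> * (real n * (2 * pi / \<omega>) + c) = \<omega> * c + 2 * real n * pi" for n and c :: real
    using assms by (simp add: field_simps)
  then have const: "cos (\<omega> * (real n * (2 * pi / \<omega>) + c)) = cos (\<omega> * c)" for n and c :: real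
    by (simp only: cos_add cos_2npi sin_2npi)
  have "l = cos (\<omega> * c)" for c
    using LIMSEQ_unique[OF seq[of c]] tendsto_const[of "cos (\<omega> * c)" sequentially] unfolding const by blast
  from this[of 0] this[of "pi / \<omega>"] show False using assms by simp
qed

lemma oscillation_not_convergent:
  fixes x :: "real^'n"
  assumes "\<omega> > 0" "x \<noteq> 0"
  shows "\<not> ((\<lambda>t. y0 + cos (\<omega> * t) *\<^sub>R x) \<longlongrightarrow> y) at_top"
proof
  assume lim: "((\<lambda>t. y0 + cos (\<omega> * t) *\<^sub>R x) \<longlongrightarrow> y) at_top"
  obtain i where i: "x $ i \<noteq> 0" using assms(2) by (auto simp: vec_eq_iff)
  have "((\<lambda>t. ((y0 + cos (\<omega> * t) *\<^sub>R x) $ i - y0 $ i) / x $ i) \<longlongrightarrow> (y $ i - y0 $ i) / x $ i) at_top"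
    using i by (intro tendsto_intros lim)
  then have "((\<lambda>t. cos (\<omega> * t)) \<longlongrightarrow> (y $ i - y0 $ i) / x $ i) at_top" using i by simp
  then show False using cos_not_convergent[OF assms(1)] by blast
qed

section \<open>Decay of the damped dynamics\<close>

text \<open>Energy dissipation bounds \<open>y\<close> and \<open>q\<close> and forces \<open>R y \<rightarrow> 0\<close>. With \<open>L = B W B^T\<close> and
  \<open>K = M^(-1) L\<close>, the second-order equation \<open>y'' = - M^(-1) R y' - K y\<close> turns
  \<open>R K^k y \<rightarrow> 0\<close> into \<open>R K^(k+1) y \<rightarrow> 0\<close>, because both derivative terms vanish in the limit.
  Limit points of \<open>y\<close> are thus unobservable through \<open>R\<close>, and the unobservable subspace is zero since
  it would otherwise contain an eigenvector.\<close>

lemma damped_output_tendsto_zero: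
  fixes M R :: "real^'n^'n" and W :: "real^'m^'m" and B :: "real^'m^'n"
    and y :: "real \<Rightarrow> real^'n" and q :: "real \<Rightarrow> real^'m"
  assumes M: "posdef M" and R: "possemidef R" and W: "posdef W"
    and y: "\<And>t. t \<ge> a \<Longrightarrow>
      (y has_vector_derivative matrix_inv M *v (- (R *v y t) - B *v (W *v q t))) (at t)"
    and q: "\<And>t. t \<ge> a \<Longrightarrow> (q has_vector_derivative transpose B *v y t) (at t)"
    and no_eigenvector:
      "\<And>\<mu> x. (B ** W ** transpose B) *v x = \<mu> *\<^sub>R (M *v x) \<Longrightarrow> R *v x = 0 \<Longrightarrow> x = 0"
  shows "(y \<longlongrightarrow> 0) at_top"
proof -
  define L where "L = B ** W ** transpose B"
  define N where "N = matrix_inv M"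
  define K where "K = N ** L"
  define y1 where "y1 = (\<lambda>t. N *v (- (R *v y t) - B *v (W *v q t)))"
  define y2 where "y2 = (\<lambda>t. N *v (- (R *v y1 t) - L *v y t))"
  define y3 where "y3 = (\<lambda>t. N *v (- (R *v y2 t) - L *v y1 t))"
  have Msym: "transpose M = M" and Rsym: "transpose R = R" and Wsym: "transpose W = W"
    using M R W by (auto simp: posdef_def possemidef_def)
  have Lsym: "transpose L = L" unfolding L_def by (rule weighted_gram_symmetric[OF Wsym])
  have Lx: "L *v x = B *v (W *v (transpose B *v x))" for x
    by (simp only: L_def matrix_vector_mul_assoc matrix_mul_assoc)
  note vector_rules = has_vector_derivative_matrix has_vector_derivative_minus
    has_vector_derivative_diff
  have d0: "(y has_vector_derivative y1 t) (at t)" if "t \<ge> a" for t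
    using y[OF that] by (simp add: y1_def N_def)
  have d1: "(y1 has_vector_derivative y2 t) (at t)" if "t \<ge> a" for t
  proof -
    have "((\<lambda>t. N *v (- (R *v y t) - B *v (W *v q t))) has_vector_derivative
        N *v (- (R *v y1 t) - B *v (W *v (transpose B *v y t)))) (at t)"
      by (rule vector_rules d0 q that)+
    then show ?thesis unfolding y2_def Lx by (simp only: y1_def)
  qed
  have d2: "(y2 has_vector_derivative y3 t) (at t)" if "t \<ge> a" for t
  proof -
    have "((\<lambda>t. N *v (- (R *v y1 t) - L *v y t)) has_vector_derivative
        N *v (- (R *v y2 t) - L *v y1 t)) (at t)"
      by (rule vector_rules d1 d0 that)+
    then show ?thesis unfolding y3_def by (simp only: y2_def)
  qed

  \<comment> \<open>the stored energy; its derivative is minus the dissipated power\<close>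
  define H where "H = (\<lambda>t. (y t \<bullet> (M *v y t) + q t \<bullet> (W *v q t)) / 2)"
  have My1: "M *v y1 t = - (R *v y t) - B *v (W *v q t)" for t
    by (simp add: y1_def N_def posdef_inverse_mult[OF M])
  have dH: "(H has_vector_derivative - (y t \<bullet> (R *v y t))) (at t)" if "t \<ge> a" for t
  proof -
    have "(H has_vector_derivative
        ((y t \<bullet> (M *v y1 t) + y1 t \<bullet> (M *v y t)) +
         (q t \<bullet> (W *v (transpose B *v y t)) + (transpose B *v y t) \<bullet> (W *v q t))) / 2) (at t)"
      unfolding H_def using that
      by (intro has_vector_derivative_divide has_vector_derivative_add
          bounded_bilinear.has_vector_derivative[OF bounded_bilinear_inner]
          has_vector_derivative_matrix d0 q)
    also have "y1 t \<bullet> (M *v y t) = y t \<bullet> (M *v y1 t)"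
      by (rule inner_symmetric_matrix[OF Msym])
    also have "q t \<bullet> (W *v (transpose B *v y t)) = (transpose B *v y t) \<bullet> (W *v q t)"
      by (rule inner_symmetric_matrix[OF Wsym])
    also have "(transpose B *v y t) \<bullet> (W *v q t) = y t \<bullet> (B *v (W *v q t))"
      by (simp add: dot_lmul_matrix)
    finally show ?thesis by (simp add: My1 inner_diff_right)
  qed
  have R0: "0 \<le> x \<bullet> (R *v x)" for x using R by (auto simp: possemidef_def)
  have M0: "0 \<le> x \<bullet> (M *v x)" for x
    using posdef_imp_possemidef[OF M] by (auto simp: possemidef_def)
  have W0: "0 \<le> x \<bullet> (W *v x)" for x
    using posdef_imp_possemidef[OF W] by (auto simp: possemidef_def)
  have H_decreasing: "H t \<le> H s" if "a \<le> s" "s \<le> t" for s t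
  proof (rule DERIV_nonpos_imp_nonincreasing[OF that(2)])
    fix x assume "s \<le> x" "x \<le> t"
    then have "(H has_vector_derivative - (y x \<bullet> (R *v y x))) (at x)" using that dH by auto
    then show "\<exists>D. DERIV H x :> D \<and> D \<le> 0"
      using R0[of "y x"] by (auto simp: has_real_derivative_iff_has_vector_derivative)
  qed
  have H_bound: "y t \<bullet> (M *v y t) \<le> 2 * H a" "q t \<bullet> (W *v q t) \<le> 2 * H a" if "t \<in> {a..}" for t
    using H_decreasing[of a t] that M0[of "y t"] W0[of "q t"] by (auto simp: H_def)
  have bq: "bounded (q ` {a..})" by (rule bounded_if_form_bounded[OF W H_bound(2)])
  have b0: "bounded (y ` {a..})" by (rule bounded_if_form_bounded[OF M H_bound(1)])
  note bdd = bounded_matrix_image bounded_uminus_image bounded_minus_comp bounded_inner_image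
  have b1: "bounded (y1 ` {a..})" unfolding y1_def by (intro bdd b0 bq)
  have b2: "bounded (y2 ` {a..})" unfolding y2_def by (intro bdd b0 b1)
  have b3: "bounded (y3 ` {a..})" unfolding y3_def by (intro bdd b2 b1)

  obtain l where "(H \<longlongrightarrow> l) at_top"
    using nonincreasing_bounded_below_tendsto[of a H 0] H_decreasing M0 W0 by (auto simp: H_def)
  then have "((\<lambda>t. - (y t \<bullet> (R *v y t))) \<longlongrightarrow> 0) at_top"
  proof (rule derivative_tendsto_zero[where a = a and f = H, rotated 3])
    show "((\<lambda>t. - (y t \<bullet> (R *v y t))) has_vector_derivative
        - (y t \<bullet> (R *v y1 t) + y1 t \<bullet> (R *v y t))) (at t)" if "t \<ge> a" for t
      using that
      by (intro has_vector_derivative_minus has_vector_derivative_matrix d0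
          bounded_bilinear.has_vector_derivative[OF bounded_bilinear_inner])
    show "bounded ((\<lambda>t. - (y t \<bullet> (R *v y1 t) + y1 t \<bullet> (R *v y t))) ` {a..})"
      by (intro bdd bounded_plus_comp b0 b1)
  qed (rule dH)
  from tendsto_minus[OF this] have dissipation: "((\<lambda>t. y t \<bullet> (R *v y t)) \<longlongrightarrow> 0) at_top"
    by simp
  have Ry: "((\<lambda>t. R *v y t) \<longlongrightarrow> 0) at_top"
    by (rule tendsto_zero_via_limit_points[OF b0, where f = "\<lambda>_::unit. \<lambda>x. x \<bullet> (R *v x)"])
      (auto intro!: continuous_intros dissipation possemidef_form_zero[OF R])

  \<comment> \<open>if a linear image of \<open>y\<close> tends to zero, so do those of its first two derivatives\<close>
  have derivatives: "((\<lambda>t. T (y1 t)) \<longlongrightarrow> 0) at_top" "((\<lambda>t. T (y2 t)) \<longlongrightarrow> 0) at_top"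
    if T: "bounded_linear T" and lim: "((\<lambda>t. T (y t)) \<longlongrightarrow> 0) at_top" for T :: "real^'n \<Rightarrow> real^'n"
  proof -
    note d = bounded_linear.has_vector_derivative[OF T]
    have b: "bounded ((\<lambda>t. T (f t)) ` {a..})" if "bounded (f ` {a..})" for f
      using bounded_linear_image[OF that T] by (simp add: image_image)
    show 1: "((\<lambda>t. T (y1 t)) \<longlongrightarrow> 0) at_top"
      by (rule derivative_tendsto_zero[OF d[OF d0] d[OF d1] b[OF b2] lim])
    show "((\<lambda>t. T (y2 t)) \<longlongrightarrow> 0) at_top"
      by (rule derivative_tendsto_zero[OF d[OF d1] d[OF d2] b[OF b3] 1])
  qed
  define T where "T = (\<lambda>k x. R *v ((((*v) K) ^^ k) x))"
  have linK: "bounded_linear (((*v) K) ^^ k)" for k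
  proof (induction k)
    case (Suc k)
    then show ?case
      using bounded_linear_compose[OF matrix_vector_mul_bounded_linear[of K] Suc] by (simp add: o_def)
  qed (simp add: id_def bounded_linear_ident)
  have linT: "bounded_linear (T k)" for k
    using bounded_linear_compose[OF matrix_vector_mul_bounded_linear[of R] linK]
    by (simp add: T_def)
  \<comment> \<open>the second-order equation, solved for \<open>K y\<close>\<close>
  have Ky: "K *v y t = - (N *v (R *v y1 t)) - y2 t" for t
    by (simp add: y2_def K_def matrix_vector_mult_diff_distrib vec.neg flip: matrix_vector_mul_assoc)
  have Ry1: "((\<lambda>t. R *v y1 t) \<longlongrightarrow> 0) at_top"
    by (rule derivatives(1)[OF matrix_vector_mul_bounded_linear Ry])
  have Ty: "((\<lambda>t. T k (y t)) \<longlongrightarrow> 0) at_top" for k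
  proof (induction k)
    case 0
    then show ?case using Ry by (simp add: T_def)
  next
    case (Suc k)
    interpret Tk: bounded_linear "T k" by (rule linT)
    have "T (Suc k) (y t) = - T k (N *v (R *v y1 t)) - T k (y2 t)" for t
      unfolding T_def funpow_Suc_right o_apply Ky
      using Tk.diff Tk.neg by (simp add: T_def)
    moreover have "((\<lambda>t. T k (N *v (R *v y1 t))) \<longlongrightarrow> T k (N *v 0)) at_top"
      by (intro Tk.tendsto bounded_linear.tendsto[OF matrix_vector_mul_bounded_linear] Ry1)
    ultimately show ?case
      using tendsto_diff[OF tendsto_minus derivatives(2)[OF linT Suc]] by (fastforce simp: Tk.zero)
  qed

  have unobservable: "x = 0" if x: "\<And>k. T k x = 0" for x
  proof (rule ccontr)
    assume "x \<noteq> 0"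
    \<comment> \<open>the unobservable subspace, invariant under \<open>K\<close> and contained in the kernel of \<open>R\<close>\<close>
    define Y where "Y = {x. \<forall>k. T k x = 0}"
    have "subspace Y"
      using linT by (auto simp: Y_def subspace_def bounded_linear.linear linear_0 linear_add linear_cmul)
    moreover have "\<exists>z\<in>Y. M *v z = L *v w" if "w \<in> Y" for w
    proof
      have "T k (K *v w) = T (Suc k) w" for k by (simp only: T_def funpow_Suc_right o_apply)
      then show "K *v w \<in> Y" using that by (auto simp: Y_def)
      show "M *v (K *v w) = L *v w"
        by (simp add: K_def N_def posdef_inverse_mult[OF M] flip: matrix_vector_mul_assoc)
    qed
    moreover have "x \<in> Y" using x by (simp add: Y_def)
    ultimately obtain u \<mu> where u: "u \<in> Y" "u \<noteq> 0" "L *v u = \<mu> *\<^sub>R (M *v u)"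
      using symmetric_eigenvector_in_invariant_subspace[OF M Lsym] \<open>x \<noteq> 0\<close> by metis
    from u(1) have "T 0 u = 0" unfolding Y_def by blast
    then have "R *v u = 0" by (simp add: T_def)
    with u no_eigenvector show False unfolding L_def by blast
  qed
  show ?thesis
  proof (rule tendsto_zero_via_limit_points[OF b0, where f = T and g = "\<lambda>x. x"])
    show "continuous_on UNIV (T k)" for k by (rule linear_continuous_on[OF linT])
    show "((\<lambda>t. T k (y t)) \<longlongrightarrow> 0) at_top" for k by (rule Ty)
    show "x = 0" if "\<And>k. T k x = 0" for x by (rule unobservable[OF that])
  qed (rule continuous_on_id)
qed

section \<open>Oscillations and equilibria\<close>

lemma undamped_oscillation:
  fixes M R :: "real^'n^'n" and W :: "real^'m^'m" and B :: "real^'m^'n" and x :: "real^'n"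
  assumes x: "(B ** W ** transpose B) *v x = \<omega>\<^sup>2 *\<^sub>R (M *v x)" "R *v x = 0" and "\<omega> \<noteq> 0"
    and inv: "matrix_inv M *v (M *v x) = x"
    and p_def: "p = (\<lambda>t. cos (\<omega> * t) *\<^sub>R (M *v x))"
    and q_def: "q = (\<lambda>t. (sin (\<omega> * t) / \<omega>) *\<^sub>R (transpose B *v x))"
  shows "(p has_vector_derivative - (R *v (matrix_inv M *v p t)) - B *v (W *v q t)) (at t within S)"
    and "(q has_vector_derivative transpose B *v (matrix_inv M *v p t)) (at t within S)"
proof -
  have N: "matrix_inv M *v p t = cos (\<omega> * t) *\<^sub>R x"
    by (simp add: p_def matrix_vector_mult_scaleR inv)
  have "B *v (W *v q t) = (sin (\<omega> * t) / \<omega>) *\<^sub>R ((B ** W ** transpose B) *v x)"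
    by (simp only: q_def matrix_vector_mult_scaleR matrix_vector_mul_assoc matrix_mul_assoc)
  then have "B *v (W *v q t) = (\<omega> * sin (\<omega> * t)) *\<^sub>R (M *v x)"
    using x \<open>\<omega> \<noteq> 0\<close> by (simp add: power2_eq_square)
  then have rhs: "- (R *v (matrix_inv M *v p t)) - B *v (W *v q t) = (- \<omega> * sin (\<omega> * t)) *\<^sub>R (M *v x)"
    by (simp add: N matrix_vector_mult_scaleR x)
  show "(p has_vector_derivative - (R *v (matrix_inv M *v p t)) - B *v (W *v q t)) (at t within S)"
    unfolding rhs unfolding p_def by (auto intro!: derivative_eq_intros)
  have "((\<lambda>t. sin (\<omega> * t) / \<omega>) has_real_derivative cos (\<omega> * t)) (at t within S)"
    using \<open>\<omega> \<noteq> 0\<close> by (auto intro!: derivative_eq_intros)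
  then show "(q has_vector_derivative transpose B *v (matrix_inv M *v p t)) (at t within S)"
    unfolding N q_def using \<open>\<omega> \<noteq> 0\<close>
    by (auto intro!: derivative_eq_intros simp: matrix_vector_mult_scaleR)
qed

text \<open>The equilibrium equation is solvable for every \<open>v\<close> because the symmetric matrix
  \<open>T = R J J^T R + B W B^T\<close> is invertible, and \<open>T w = v\<close> provides \<open>\<beta> = J^T R w\<close> and
  \<open>q = B^T w\<close>. Indeed \<open>w \<bullet> T w = 0\<close> gives \<open>J^T R w = 0\<close> and \<open>B^T w = 0\<close>, so \<open>w\<close> lies in the
  range of \<open>J\<close>, and then \<open>w \<bullet> R w = 0\<close>.\<close>

lemma equilibrium_exists:
  fixes R :: "real^'n^'n" and W :: "real^'m^'m" and B :: "real^'m^'n" and J :: "real^'k^'n"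
  assumes R: "possemidef R" and W: "posdef W"
    and span: "\<And>w. transpose B *v w = 0 \<Longrightarrow> \<exists>\<gamma>. w = J *v \<gamma>"
    and ker: "\<And>w. transpose B *v w = 0 \<Longrightarrow> R *v w = 0 \<Longrightarrow> w = 0"
  obtains \<beta> q where "R *v (J *v \<beta>) + B *v (W *v q) = v"
proof -
  define T where "T = R ** J ** transpose J ** R + B ** W ** transpose B"
  have Rsym: "transpose R = R" using R by (simp add: possemidef_def)
  have T: "T *v w = R *v (J *v (transpose J *v (R *v w))) + B *v (W *v (transpose B *v w))" for w
    by (simp only: T_def matrix_vector_mult_add_rdistrib matrix_vector_mul_assoc matrix_mul_assoc)
  have "w = 0" if "T *v w = 0" for w
  proof -
    let ?J = "transpose J *v (R *v w)" and ?B = "transpose B *v w"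
    have "w \<bullet> (R *v (J *v ?J)) = ?J \<bullet> ?J"
    proof -
      have "w \<bullet> (R *v (J *v ?J)) = (J *v ?J) \<bullet> (R *v w)" by (rule inner_symmetric_matrix[OF Rsym])
      then show ?thesis by (simp add: dot_lmul_matrix inner_commute)
    qed
    moreover have "w \<bullet> (B *v (W *v ?B)) = ?B \<bullet> (W *v ?B)"
      by (simp add: dot_lmul_matrix)
    moreover have "w \<bullet> (T *v w) = 0" using that by simp
    ultimately have sum: "?J \<bullet> ?J + ?B \<bullet> (W *v ?B) = 0"
      by (simp only: T inner_add_right)
    have "0 \<le> ?B \<bullet> (W *v ?B)"
      using posdef_imp_possemidef[OF W] unfolding possemidef_def by blast
    then have "?J \<bullet> ?J = 0" "?B \<bullet> (W *v ?B) = 0"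
      using sum inner_ge_zero[of ?J] by linarith+
    then have J: "?J = 0" and B: "?B = 0" using posdef_form_zero[OF W] by (auto simp only: inner_eq_zero_iff)
    obtain \<gamma> where "w = J *v \<gamma>" using span[OF B] by blast
    then have "w \<bullet> (R *v w) = \<gamma> \<bullet> ?J"
      using dot_lmul_matrix[of "R *v w" J \<gamma>] by (simp add: inner_commute)
    then have "R *v w = 0" using J possemidef_form_zero[OF R] by (simp only: inner_zero_right)
    then show "w = 0" using ker B by blast
  qed
  then have "invertible T"
    unfolding invertible_left_inverse matrix_left_invertible_ker by blast
  then obtain S where "T ** S = mat 1" unfolding invertible_def by blast
  then have "T *v (S *v v) = v" by (simp add: matrix_vector_mul_assoc)
  with T[of "S *v v"] that show ?thesis by metis
qed

section \<open>Complex eigenvectors of real symmetric pencils\<close>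

definition cvec :: "real^'n \<Rightarrow> real^'n \<Rightarrow> complex^'n" where
  "cvec a b = (\<chi> i. Complex (a $ i) (b $ i))"

lemma cvec_cases: obtains a b where "x = cvec a b"
proof
  show "x = cvec (\<chi> i. Re (x $ i)) (\<chi> i. Im (x $ i))"
    by (simp add: cvec_def vec_eq_iff)
qed

lemma cvec_eq_iff [simp]: "cvec a b = cvec c d \<longleftrightarrow> a = c \<and> b = d"
  by (auto simp: cvec_def vec_eq_iff)

lemma cvec_eq_0_iff [simp]: "cvec a b = 0 \<longleftrightarrow> a = 0 \<and> b = 0"
  by (auto simp: cvec_def vec_eq_iff complex_eq_iff)

lemma cmat_mult_cvec: "cmat A *v cvec a b = cvec (A *v a) (A *v b)"
  by (simp add: cmat_def cvec_def map_matrix_def matrix_vector_mult_def vec_eq_iff complex_eq_iff)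

lemma scale_cvec: "\<mu> *s cvec a b = cvec (Re \<mu> *\<^sub>R a - Im \<mu> *\<^sub>R b) (Re \<mu> *\<^sub>R b + Im \<mu> *\<^sub>R a)"
  by (simp add: cvec_def vec_eq_iff complex_eq_iff)

lemma mat_scalar_mult: "mat \<mu> *v x = \<mu> *s x" for x :: "'a::comm_semiring_1^'n"
  by (simp add: matrix_vector_mult_def mat_def vec_eq_iff if_distrib if_distribR cong: if_cong)

lemma ker_minus_scalar: "x \<in> ker (A - mat \<mu>) \<longleftrightarrow> A *v x = \<mu> *s x" for A :: "complex^'n^'n"
  by (simp add: ker_def matrix_vector_mult_diff_rdistrib mat_scalar_mult)

lemma zero_in_ker: "0 \<in> ker A"
  by (simp add: ker_def)

text \<open>If \<open>S' (a + i b) = \<mu> M (a + i b)\<close> with \<open>S'\<close> symmetric, comparing \<open>b \<bullet> S' a\<close> with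
  \<open>a \<bullet> S' b\<close> gives \<open>Im \<mu> (a \<bullet> M a + b \<bullet> M b) = 0\<close>; hence \<open>\<mu>\<close> is real and \<open>a\<close>, \<open>b\<close> are real
  eigenvectors. The pair \<open>S\<close>, \<open>S'\<close> serves the Kron-reduced Laplacian, which agrees on
  the kernel of \<open>L_ii\<close> with its first summand, a Gram matrix.\<close>

lemma no_eigenvector_in_kernel_iff_real:
  fixes M S S' :: "real^'n^'n" and C :: "real^'n^'m"
  assumes M: "posdef M" and S': "transpose S' = S'"
    and agree: "\<And>x. C *v x = 0 \<Longrightarrow> S *v x = S' *v x"
  shows "(\<forall>\<mu>\<in>spectrum (matrix_inv M ** S).
            ker (cmat (matrix_inv M ** S) - mat \<mu>) \<inter> ker (cmat C) = {0})
     \<longleftrightarrow> (\<forall>\<mu> x. S' *v x = \<mu> *\<^sub>R (M *v x) \<longrightarrow> C *v x = 0 \<longrightarrow> x = 0)"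
    (is "?complex \<longleftrightarrow> ?real")
proof
  assume complex: ?complex
  show ?real
  proof (intro allI impI, rule ccontr)
    fix \<mu> x assume x: "S' *v x = \<mu> *\<^sub>R (M *v x)" "C *v x = 0" "x \<noteq> 0"
    then have "(matrix_inv M ** S) *v x = \<mu> *\<^sub>R x"
      by (simp add: agree matrix_vector_mult_scaleR posdef_inverse_mult[OF M] flip: matrix_vector_mul_assoc)
    then have eig: "cmat (matrix_inv M ** S) *v cvec x 0 = of_real \<mu> *s cvec x 0"
      by (simp add: cmat_mult_cvec scale_cvec)
    have nz: "cvec x 0 \<noteq> 0" using x by simp
    have "of_real \<mu> \<in> spectrum (matrix_inv M ** S)"
      using eig nz unfolding spectrum_def by blast
    moreover have "cvec x 0 \<in> ker (cmat (matrix_inv M ** S) - mat (of_real \<mu>)) \<inter> ker (cmat C)"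
      using eig x unfolding Int_iff ker_minus_scalar by (simp add: ker_def cmat_mult_cvec)
    ultimately show False using complex nz by blast
  qed
next
  assume real: ?real
  have "x = 0" if x: "cmat (matrix_inv M ** S) *v x = \<mu> *s x" "cmat C *v x = 0" for \<mu> x
  proof -
    obtain a b where ab: "x = cvec a b" by (rule cvec_cases)
    define \<alpha> \<beta> where "\<alpha> = Re \<mu>" and "\<beta> = Im \<mu>"
    have C: "C *v a = 0" "C *v b = 0" using x(2) by (simp_all add: ab cmat_mult_cvec)
    have "matrix_inv M *v (S *v a) = \<alpha> *\<^sub>R a - \<beta> *\<^sub>R b"
      "matrix_inv M *v (S *v b) = \<alpha> *\<^sub>R b + \<beta> *\<^sub>R a"
      using x(1) by (simp_all add: ab \<alpha>_def \<beta>_def cmat_mult_cvec scale_cvec matrix_vector_mul_assoc)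
    then have "M *v (matrix_inv M *v (S *v a)) = M *v (\<alpha> *\<^sub>R a - \<beta> *\<^sub>R b)"
      "M *v (matrix_inv M *v (S *v b)) = M *v (\<alpha> *\<^sub>R b + \<beta> *\<^sub>R a)"
      by simp_all
    then have S'ab: "S' *v a = \<alpha> *\<^sub>R (M *v a) - \<beta> *\<^sub>R (M *v b)"
      "S' *v b = \<alpha> *\<^sub>R (M *v b) + \<beta> *\<^sub>R (M *v a)"
      by (simp_all add: posdef_inverse_mult[OF M] agree C matrix_vector_mult_diff_distrib
          matrix_vector_right_distrib matrix_vector_mult_scaleR)
    have Msym: "transpose M = M" using M by (simp add: posdef_def)
    have "b \<bullet> (S' *v a) = a \<bullet> (S' *v b)" by (rule inner_symmetric_matrix[OF S'])
    then have "\<beta> * (a \<bullet> (M *v a) + b \<bullet> (M *v b)) = 0"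
      using inner_symmetric_matrix[OF Msym, of a b]
      by (simp add: S'ab inner_add_right inner_diff_right algebra_simps)
    moreover have "0 \<le> a \<bullet> (M *v a)" "0 \<le> b \<bullet> (M *v b)"
      using posdef_imp_possemidef[OF M] unfolding possemidef_def by blast+
    ultimately have "\<beta> = 0 \<or> a \<bullet> (M *v a) = 0 \<and> b \<bullet> (M *v b) = 0" by auto
    then have "a = 0 \<and> b = 0"
    proof
      assume "\<beta> = 0"
      then show ?thesis using S'ab real C by (metis diff_zero add_0_right scaleR_zero_left)
    qed (use posdef_form_zero[OF M] in blast)
    then show ?thesis by (simp add: ab)
  qed
  then show ?complex
    using zero_in_ker unfolding ker_minus_scalar[symmetric] by (auto simp: ker_def)
qed

section \<open>Block-diagonal matrices and weighted Gram matrices\<close>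

definition node_block :: "'a^('i::finite \<times> 'r::finite) \<Rightarrow> 'i \<Rightarrow> 'a^'r" where
  "node_block x i = (\<chi> a. x $ (i, a))"

lemma sum_UNIV_prod: "(\<Sum>p\<in>UNIV. f p) = (\<Sum>i\<in>UNIV. \<Sum>a\<in>UNIV. f (i, a))"
  for f :: "'i::finite \<times> 'r::finite \<Rightarrow> 'b::comm_monoid_add"
  by (simp add: sum.cartesian_product UNIV_Times_UNIV[symmetric] del: UNIV_Times_UNIV)

lemma node_block_block_diag: "node_block (block_diag A *v x) i = A i *v node_block x i"
  for A :: "'i::finite \<Rightarrow> real^'r::finite^'r"
  by (simp add: node_block_def block_diag_def matrix_vector_mult_def vec_eq_iff sum_UNIV_prod
      if_distrib if_distribR sum.If_cases cong: if_cong)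

lemma inner_node_blocks: "x \<bullet> y = (\<Sum>i\<in>UNIV. node_block x i \<bullet> node_block y i)"
  for x y :: "real^('i::finite \<times> 'r::finite)"
  by (simp add: inner_vec_def sum_UNIV_prod node_block_def)

lemma node_block_eq_0: "x = 0 \<longleftrightarrow> (\<forall>i. node_block x i = 0)"
  by (auto simp: node_block_def vec_eq_iff)

lemma transpose_block_diag: "transpose (block_diag A) = block_diag (\<lambda>i. transpose (A i))"
  by (simp add: block_diag_def transpose_def vec_eq_iff)

lemma possemidef_block_diag:
  fixes A :: "'i::finite \<Rightarrow> real^'r::finite^'r"
  assumes "\<And>i. possemidef (A i)"
  shows "possemidef (block_diag A)"
  using assms unfolding possemidef_def inner_node_blocks transpose_block_diag node_block_block_diag
  by (auto intro!: sum_nonneg)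

lemma posdef_block_diag:
  fixes A :: "'i::finite \<Rightarrow> real^'r::finite^'r"
  assumes "\<And>i. posdef (A i)"
  shows "posdef (block_diag A)"
  unfolding posdef_def
proof (intro conjI allI impI)
  show "transpose (block_diag A) = block_diag A"
    using assms by (simp add: transpose_block_diag posdef_def)
  fix x :: "real^('i \<times> 'r)" assume "x \<noteq> 0"
  then obtain i where "node_block x i \<noteq> 0" unfolding node_block_eq_0 by blast
  then have "0 < node_block x i \<bullet> (A i *v node_block x i)"
    using assms by (simp add: posdef_def)
  moreover have "0 \<le> node_block x j \<bullet> (A j *v node_block x j)" for j
    using posdef_imp_possemidef[OF assms] unfolding possemidef_def by blast
  ultimately show "0 < x \<bullet> (block_diag A *v x)"
    unfolding inner_node_blocks node_block_block_diag by (intro sum_pos2) auto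
qed

text \<open>All Laplacian blocks have this shape. The edge classes enter as zero columns of \<open>F\<close> and \<open>G\<close>, so
  one entrywise formula reduces identities between the blocks to statements about single edges.\<close>

lemma weighted_gram_entry:
  fixes F :: "real^'e::finite^'n::finite" and G :: "real^'e^'m::finite" and W :: "'e \<Rightarrow> real^'r::finite^'r"
  shows "(kron F (mat 1) ** block_diag W ** transpose (kron G (mat 1))) $ p $ q =
    (\<Sum>k\<in>UNIV. F $ fst p $ k * G $ fst q $ k * W k $ snd p $ snd q)"
proof -
  have left: "(kron F (mat 1) ** block_diag W) $ p $ l = F $ fst p $ fst l * W (fst l) $ snd p $ snd l" for l
  proof -
    have "(kron F (mat 1) ** block_diag W) $ p $ l =
       (\<Sum>s\<in>UNIV. kron F (mat 1) $ p $ s * block_diag W $ s $ l)"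
      by (simp add: matrix_matrix_mult_def)
    also have "\<dots> = (\<Sum>s\<in>UNIV. if s = (fst l, snd p) then F $ fst p $ fst l * W (fst l) $ snd p $ snd l else 0)"
      by (rule sum.cong) (auto simp: kron_def block_diag_def mat_def)
    finally show ?thesis by simp
  qed
  have "(kron F (mat 1) ** block_diag W ** transpose (kron G (mat 1))) $ p $ q =
    (\<Sum>s\<in>UNIV. (kron F (mat 1) ** block_diag W) $ p $ s * kron G (mat 1) $ q $ s)"
    by (simp add: matrix_matrix_mult_def[of "kron F (mat 1) ** block_diag W"] transpose_def)
  also have "\<dots> = (\<Sum>k\<in>UNIV. \<Sum>c\<in>UNIV.
      if c = snd q then F $ fst p $ k * G $ fst q $ k * W k $ snd p $ snd q else 0)"
    unfolding left sum_UNIV_prod by (intro sum.cong refl) (simp add: kron_def mat_def)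
  finally show ?thesis by simp
qed

section \<open>Restriction to the undamped nodes\<close>

lemma vstack_mult_nth:
  "(vstack A C *v z) $ p = (case fst p of Inl i \<Rightarrow> (A *v z) $ (i, snd p) | Inr i \<Rightarrow> (C *v z) $ (i, snd p))"
  by (simp add: vstack_def matrix_vector_mult_def split: sum.split)

lemma vstack_mult_eq_iff:
  "vstack A C *v y = vstack A' C' *v z \<longleftrightarrow> A *v y = A' *v z \<and> C *v y = C' *v z"
  by (simp add: vec_eq_iff vstack_mult_nth split_sum_all)

lemma vstack_mult_eq_0_iff:
  "vstack A C *v z = 0 \<longleftrightarrow> A *v z = 0 \<and> C *v z = 0"
  by (simp add: vec_eq_iff vstack_mult_nth split_sum_all)

definition embed_u :: "real^('u::finite \<times> 'r::finite)^(('d::finite + 'u) \<times> 'r)" where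
  "embed_u = vstack 0 (mat 1)"

lemma embed_u_mult_eq_iff:
  "embed_u *v z = x \<longleftrightarrow> (\<forall>i a. x $ (Inl i, a) = 0) \<and> (\<forall>i a. x $ (Inr i, a) = z $ (i, a))"
  by (auto simp: vec_eq_iff embed_u_def vstack_mult_nth split_sum_all)

lemma mult_embed_u:
  fixes A :: "real^(('d::finite + 'u::finite) \<times> 'r::finite)^'n"
  shows "A ** embed_u = (\<chi> p q. A $ p $ (Inr (fst q), snd q))"
proof -
  have "embed_u $ s $ q = (if s = (Inr (fst q), snd q) then 1 else 0)" for s :: "('d + 'u) \<times> 'r" and q
    by (cases s; cases q) (auto simp: embed_u_def vstack_def mat_def split: sum.split)
  then have "(A ** embed_u) $ p $ q = (\<Sum>s\<in>UNIV. if s = (Inr (fst q), snd q) then A $ p $ s else 0)" for p q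
    unfolding matrix_matrix_mult_def vec_lambda_beta by (intro sum.cong) auto
  then show ?thesis by (simp add: vec_eq_iff)
qed

lemma block_diag_embed_u: "block_diag A ** embed_u = vstack 0 (block_u A)"
  by (simp add: mult_embed_u vec_eq_iff split_sum_all vstack_def block_diag_def block_u_def)

lemma BB_d_eq_kron:
  "BB_d S tail head = kron (\<chi> i k. if k \<in> S then incidence tail head $ Inl i $ k else 0) (mat 1)"
  by (simp add: BB_d_def BB_def kron_def vec_eq_iff)

lemma BB_u_eq_kron:
  "BB_u S tail head = kron (\<chi> i k. if k \<in> S then incidence tail head $ Inr i $ k else 0) (mat 1)"
  by (simp add: BB_u_def BB_def kron_def vec_eq_iff)

text \<open>Only mixed edges join a damped to an undamped
  node; an edge that touches an undamped node is either mixed or joins two undamped nodes, never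
  both.\<close>

lemma laplacian_embed_u:
  fixes tail head :: "'e::finite \<Rightarrow> 'd::finite + 'u::finite" and W :: "'e \<Rightarrow> real^'r::finite^'r"
  shows "laplacian tail head W ** embed_u = vstack (L_ii tail head W) (L_uu tail head W + L_ui tail head W)"
proof -
  note entries = weighted_gram_entry BB_d_eq_kron BB_u_eq_kron
  have lap: "laplacian tail head W $ p $ q =
      (\<Sum>k\<in>UNIV. incidence tail head $ fst p $ k * incidence tail head $ fst q $ k * W k $ snd p $ snd q)" for p q
    by (simp add: laplacian_def BB_def weighted_gram_entry)
  have edge_i: "incidence tail head $ Inl i $ k * incidence tail head $ Inr j $ k = 0" if "k \<notin> edges_i tail head" for i j k
    using that by (cases "tail k"; cases "head k") (auto simp: incidence_def edges_i_def)
  have edge_u: "incidence tail head $ Inr j $ k = 0" if "k \<notin> edges_i tail head" "k \<notin> edges_u tail head" for j k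
    using that by (cases "tail k"; cases "head k") (auto simp: incidence_def edges_i_def edges_u_def)
  have disjoint: "\<not> (k \<in> edges_i tail head \<and> k \<in> edges_u tail head)" for k
    by (auto simp: edges_i_def edges_u_def)
  have "laplacian tail head W $ (Inl i, a) $ (Inr j, b) = L_ii tail head W $ (i, a) $ (j, b)" for i j a b
    using edge_i unfolding lap L_ii_def W_on_def entries
    by (intro sum.cong refl) auto
  moreover have "laplacian tail head W $ (Inr i, a) $ (Inr j, b) =
      (L_uu tail head W + L_ui tail head W) $ (i, a) $ (j, b)" for i j a b
    using edge_u disjoint unfolding lap L_uu_def L_ui_def W_on_def entries vector_add_component sum.distrib[symmetric]
    by (intro sum.cong refl) auto
  ultimately show ?thesis
    by (simp add: mult_embed_u vec_eq_iff split_sum_all vstack_def)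
qed

lemma ker_damping_zero_at_damped:
  assumes "\<And>i. posdef (R (Inl i))" "block_diag R *v x = 0"
  shows "x $ (Inl i, a) = 0"
proof -
  have "R (Inl i) *v node_block x (Inl i) = 0"
    using assms(2) by (simp add: node_block_eq_0 node_block_block_diag)
  then have "node_block x (Inl i) = 0" using posdef_form_zero[OF assms(1)[of i]] by simp
  then show ?thesis by (simp add: node_block_def vec_eq_iff)
qed

lemma ker_damping_in_range_embed_u:
  fixes x :: "real^(('d::finite + 'u::finite) \<times> 'r::finite)"
  assumes "\<And>i. posdef (R (Inl i))" "block_diag R *v x = 0"
  obtains z where "x = embed_u *v z"
proof
  show "x = embed_u *v (\<chi> q. x $ (Inr (fst q), snd q))"
    using ker_damping_zero_at_damped[OF assms] by (simp add: eq_commute[of x] embed_u_mult_eq_iff)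
qed

text \<open>Eigenvectors in the kernel of the damping are supported on the undamped nodes; at the damped
  nodes the eigenvalue equation then reads \<open>L_ii z = 0\<close>.\<close>

lemma undamped_eigenvectors_iff:
  fixes tail head :: "'e::finite \<Rightarrow> 'd::finite + 'u::finite"
    and M R :: "'d + 'u \<Rightarrow> real^'r::finite^'r"
  assumes damped: "\<And>i. posdef (R (Inl i))"
  shows "(\<forall>\<mu> z. (L_uu tail head W + L_ui tail head W) *v z = \<mu> *\<^sub>R (block_u M *v z)
            \<longrightarrow> vstack (L_ii tail head W) (block_u R) *v z = 0 \<longrightarrow> z = 0)
     \<longleftrightarrow> (\<forall>\<mu> x. laplacian tail head W *v x = \<mu> *\<^sub>R (block_diag M *v x)
            \<longrightarrow> block_diag R *v x = 0 \<longrightarrow> x = 0)"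
    (is "?undamped \<longleftrightarrow> ?all")
proof -
  have L: "laplacian tail head W *v (embed_u *v z) = vstack (L_ii tail head W) (L_uu tail head W + L_ui tail head W) *v z"
    and M: "block_diag M *v (embed_u *v z) = vstack 0 (block_u M) *v z"
    and R: "block_diag R *v (embed_u *v z) = vstack 0 (block_u R) *v z" for z
    by (simp_all only: matrix_vector_mul_assoc laplacian_embed_u block_diag_embed_u)
  have scale: "\<mu> *\<^sub>R (A *v z) = A *v (\<mu> *\<^sub>R z)" for \<mu> z and A :: "real^'k^'l"
    by (simp add: matrix_vector_mult_scaleR)
  have eigen: "laplacian tail head W *v (embed_u *v z) = \<mu> *\<^sub>R (block_diag M *v (embed_u *v z)) \<longleftrightarrow>
      L_ii tail head W *v z = 0 \<and> (L_uu tail head W + L_ui tail head W) *v z = \<mu> *\<^sub>R (block_u M *v z)" for \<mu> z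
    unfolding L M scale vstack_mult_eq_iff by simp
  have kernel: "block_diag R *v (embed_u *v z) = 0 \<longleftrightarrow> block_u R *v z = 0" for z
    by (simp add: R vstack_mult_eq_0_iff)
  have zero: "(embed_u :: real^('u \<times> 'r)^(('d + 'u) \<times> 'r)) *v z = 0 \<longleftrightarrow> z = 0" for z
    by (simp add: embed_u_mult_eq_iff) (simp add: vec_eq_iff)
  show ?thesis
  proof
    assume undamped: ?undamped
    show ?all
    proof (intro allI impI)
      fix \<mu> x
      assume x: "laplacian tail head W *v x = \<mu> *\<^sub>R (block_diag M *v x)" "block_diag R *v x = 0"
      obtain z where z: "x = embed_u *v z" using ker_damping_in_range_embed_u[OF damped x(2)] by blast
      have "L_ii tail head W *v z = 0" "(L_uu tail head W + L_ui tail head W) *v z = \<mu> *\<^sub>R (block_u M *v z)"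
        "block_u R *v z = 0"
        using x unfolding z eigen kernel by blast+
      then have "z = 0" using undamped unfolding vstack_mult_eq_0_iff by blast
      then show "x = 0" by (simp add: z)
    qed
  next
    assume all: ?all
    show ?undamped
    proof (intro allI impI)
      fix \<mu> z
      assume z: "(L_uu tail head W + L_ui tail head W) *v z = \<mu> *\<^sub>R (block_u M *v z)"
        "vstack (L_ii tail head W) (block_u R) *v z = 0"
      have "(embed_u :: real^('u \<times> 'r)^(('d + 'u) \<times> 'r)) *v z = 0"
        using z all[rule_format, of "embed_u *v z" \<mu>] by (simp add: eigen kernel vstack_mult_eq_0_iff)
      then show "z = 0" by (simp add: zero)
    qed
  qed
qed

section \<open>The kernel of the transposed incidence matrix\<close>

lemma transpose_BB_mult_nth:
  fixes x :: "real^('n::finite \<times> 'r::finite)"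
  assumes "tail k \<noteq> head k"
  shows "(transpose (BB tail head) *v x) $ (k, a) = x $ (head k, a) - x $ (tail k, a)"
proof -
  have "(transpose (BB tail head) *v x) $ (k, a) =
      (\<Sum>p\<in>UNIV. (if p = (head k, a) then x $ p else 0) - (if p = (tail k, a) then x $ p else 0))"
    using assms unfolding matrix_vector_mult_def
    by (auto simp: transpose_def BB_def kron_def incidence_def mat_def intro!: sum.cong)
  then show ?thesis by (simp add: sum_subtractf)
qed

lemma II_mult_nth: "(II *v \<beta>) $ (i, a) = \<beta> $ (1, a)"
proof -
  have "(II *v \<beta>) $ (i, a) = (\<Sum>p\<in>UNIV. if p = (1, a) then \<beta> $ p else 0)"
    unfolding matrix_vector_mult_def vec_lambda_beta
    by (intro sum.cong) (auto simp: II_def kron_def columnvector_def vec_def mat_def num1_eq1)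
  then show ?thesis by simp
qed

lemma transpose_BB_II:
  assumes "\<And>k. tail k \<noteq> head k"
  shows "transpose (BB tail head) *v (II *v \<beta>) = 0"
  by (simp add: vec_eq_iff transpose_BB_mult_nth assms II_mult_nth del: transpose_matrix_vector)

text \<open>Vanishing potential differences along the edges propagate along paths.\<close>

lemma transpose_BB_ker_connected:
  fixes x :: "real^('n::finite \<times> 'r::finite)"
  assumes "\<And>k. tail k \<noteq> head k" "connected_graph tail head" "transpose (BB tail head) *v x = 0"
  shows "x $ (i, a) = x $ (j, a)"
proof -
  have edge: "x $ (head k, a) = x $ (tail k, a)" for k
    using transpose_BB_mult_nth[of tail k head x a] assms by simp
  have "(i, j) \<in> (\<Union>k. {(tail k, head k), (head k, tail k)})\<^sup>*"
    using assms(2) by (auto simp: connected_graph_def)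
  then show ?thesis by (induction rule: rtrancl_induct) (auto simp: edge)
qed

section \<open>Trajectories of the system\<close>

text \<open>Subtracting the equilibrium removes \<open>v\<close>. Times from \<open>1\<close> on are considered because the
  differential equation holds only one-sidedly at time \<open>0\<close>.\<close>

lemma trajectory_output_converges:
  fixes tail head :: "'e::finite \<Rightarrow> 'n::finite"
    and M R :: "'n \<Rightarrow> real^'r::finite^'r" and W :: "'e \<Rightarrow> real^'r^'r"
  assumes M: "posdef (block_diag M)" and R: "possemidef (block_diag R)" and W: "posdef (block_diag W)"
    and eq: "block_diag R *v y0 + BB tail head *v (block_diag W *v q0) = v"
      "transpose (BB tail head) *v y0 = 0"
    and no_eigenvector: "\<And>\<mu> x. laplacian tail head W *v x = \<mu> *\<^sub>R (block_diag M *v x)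
      \<Longrightarrow> block_diag R *v x = 0 \<Longrightarrow> x = 0"
    and traj: "trajectory tail head M R W v p q"
  shows "(system_output M p \<longlongrightarrow> y0) at_top"
proof -
  let ?N = "matrix_inv (block_diag M)" and ?B = "BB tail head :: real^('e \<times> 'r)^('n \<times> 'r)"
  have within: "at t within {0..} = at t" if "1 \<le> t" for t :: real
    using that by (intro at_within_interior) simp
  have "((\<lambda>t. ?N *v p t - y0) \<longlongrightarrow> 0) at_top"
  proof (rule damped_output_tendsto_zero[OF M R W, where a = 1 and B = ?B and q = "\<lambda>t. q t - q0"])
    fix t :: real assume t: "1 \<le> t"
    have p: "(p has_vector_derivative
        - (block_diag R *v (?N *v p t)) - ?B *v (block_diag W *v q t) + v) (at t)"
      and q: "(q has_vector_derivative transpose ?B *v (?N *v p t)) (at t)"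
      using traj t unfolding trajectory_def matrix_vector_mul_assoc within[OF t, symmetric]
      by (simp_all del: transpose_matrix_vector)
    from p have "(p has_vector_derivative
        - (block_diag R *v (?N *v p t - y0)) - ?B *v (block_diag W *v (q t - q0))) (at t)"
      by (simp add: eq(1)[symmetric] matrix_vector_mult_diff_distrib algebra_simps)
    from has_vector_derivative_diff[OF has_vector_derivative_matrix[OF this] has_vector_derivative_const]
    show "((\<lambda>t. ?N *v p t - y0) has_vector_derivative
        ?N *v (- (block_diag R *v (?N *v p t - y0)) - ?B *v (block_diag W *v (q t - q0)))) (at t)"
      by simp
    from has_vector_derivative_diff[OF q has_vector_derivative_const, of q0]
    show "((\<lambda>t. q t - q0) has_vector_derivative transpose ?B *v (?N *v p t - y0)) (at t)"
      using eq(2) by (simp add: matrix_vector_mult_diff_distrib del: transpose_matrix_vector)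
  qed (use no_eigenvector in \<open>auto simp: laplacian_def\<close>)
  then show ?thesis
    using Lim_null by (fastforce simp: system_output_def[abs_def])
qed

text \<open>The undamped oscillation, superposed on the equilibrium so that it solves the system with
  the given \<open>v\<close>.\<close>

lemma oscillating_trajectory:
  fixes tail head :: "'e::finite \<Rightarrow> 'n::finite"
    and M R :: "'n \<Rightarrow> real^'r::finite^'r" and W :: "'e \<Rightarrow> real^'r^'r"
  assumes M: "posdef (block_diag M)"
    and eq: "block_diag R *v y0 + BB tail head *v (block_diag W *v q0) = v"
      "transpose (BB tail head) *v y0 = 0"
    and x: "laplacian tail head W *v x = \<omega>\<^sup>2 *\<^sub>R (block_diag M *v x)" "block_diag R *v x = 0"
    and "\<omega> \<noteq> 0"
  obtains p q where "trajectory tail head M R W v p q"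
    "\<And>t. system_output M p t = y0 + cos (\<omega> * t) *\<^sub>R x"
proof
  let ?N = "matrix_inv (block_diag M)" and ?B = "BB tail head :: real^('e \<times> 'r)^('n \<times> 'r)"
  define p where "p = (\<lambda>t. cos (\<omega> * t) *\<^sub>R (block_diag M *v x))"
  define q where "q = (\<lambda>t. (sin (\<omega> * t) / \<omega>) *\<^sub>R (transpose ?B *v x))"
  note osc = undamped_oscillation[OF x[unfolded laplacian_def] \<open>\<omega> \<noteq> 0\<close> posdef_inverse_mult(1)[OF M]
      p_def q_def]
  define P where "P = (\<lambda>t. block_diag M *v y0 + p t)"
  define Q where "Q = (\<lambda>t. q0 + q t)"
  have NP: "?N *v P t = y0 + ?N *v p t" for t
    by (simp add: P_def matrix_vector_right_distrib posdef_inverse_mult[OF M])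
  show "system_output M P t = y0 + cos (\<omega> * t) *\<^sub>R x" for t
    by (simp add: system_output_def NP p_def matrix_vector_mult_scaleR posdef_inverse_mult[OF M])
  show "trajectory tail head M R W v P Q"
    unfolding trajectory_def
  proof (intro allI impI conjI)
    fix t :: real
    from has_vector_derivative_add[OF has_vector_derivative_const osc(1)]
    have "(P has_vector_derivative 0 + (- (block_diag R *v (?N *v p t)) - ?B *v (block_diag W *v q t)))
        (at t within {0..})" unfolding P_def .
    then show "(P has_vector_derivative - (block_diag R ** ?N *v P t) - (?B ** block_diag W *v Q t) + v)
        (at t within {0..})"
      by (simp add: Q_def NP eq(1)[symmetric] matrix_vector_right_distrib flip: matrix_vector_mul_assoc)
    from has_vector_derivative_add[OF has_vector_derivative_const osc(2)]
    have "(Q has_vector_derivative 0 + transpose ?B *v (?N *v p t)) (at t within {0..})"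
      unfolding Q_def .
    then show "(Q has_vector_derivative transpose ?B ** ?N *v P t) (at t within {0..})"
      using eq(2)
      by (simp add: NP matrix_vector_right_distrib del: transpose_matrix_vector flip: matrix_vector_mul_assoc)
  qed
qed

section \<open>The equivalences\<close>

text \<open>Connectedness enters through the kernel of \<open>B^T\<close>, which consists of the vectors that are
  constant over the nodes: they form the image of \<open>II\<close>, and as some node is damped, none but
  \<open>0\<close> lies in the kernel of \<open>R\<close>. Both facts yield an equilibrium, and the second gives \<open>\<mu> > 0\<close>.\<close>

lemma convergence_iff_no_undamped_eigenvector:
  fixes tail head :: "'e::finite \<Rightarrow> 'd::finite + 'u::finite"
    and M R :: "'d + 'u \<Rightarrow> real^'r::finite^'r"
    and W :: "'e \<Rightarrow> real^'r^'r"
    and v :: "real^(('d + 'u) \<times> 'r)"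
  assumes graph: "oriented_graph tail head" "connected_graph tail head"
    and M: "\<And>i. posdef (M i)" and R: "\<And>i. possemidef (R i)" and W: "\<And>k. posdef (W k)"
    and damped: "\<And>i. posdef (R (Inl i))"
  shows "(\<forall>p q. trajectory tail head M R W v p q \<longrightarrow>
          (\<exists>y\<in>im II. (system_output M p \<longlongrightarrow> y) at_top))
      \<longleftrightarrow> (\<forall>\<mu> x. laplacian tail head W *v x = \<mu> *\<^sub>R (block_diag M *v x)
            \<longrightarrow> block_diag R *v x = 0 \<longrightarrow> x = 0)"
    (is "?converges \<longleftrightarrow> ?no_eigenvector")
proof -
  let ?B = "BB tail head :: real^('e \<times> 'r)^(('d + 'u) \<times> 'r)"
  have Mp: "posdef (block_diag M)" and Rp: "possemidef (block_diag R)" and Wp: "posdef (block_diag W)"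
    using M R W by (auto intro: posdef_block_diag possemidef_block_diag)
  have no_loop: "tail k \<noteq> head k" for k using graph by (auto simp: oriented_graph_def)
  have const: "x $ (i, a) = x $ (j, a)" if "transpose ?B *v x = 0" for x i j a
    using transpose_BB_ker_connected[OF no_loop graph(2) that] .
  have span: "\<exists>\<gamma>. x = II *v \<gamma>" if "transpose ?B *v x = 0" for x
  proof
    \<comment> \<open>the value at an arbitrary node serves as the common value\<close>
    show "x = II *v (\<chi> s. x $ (undefined, snd s))"
      using const[OF that] by (simp add: vec_eq_iff II_mult_nth)
  qed
  have ker: "x = 0" if "transpose ?B *v x = 0" "block_diag R *v x = 0" for x
  proof -
    have "x $ (i, a) = 0" for i a
      using const[OF that(1), of i a "Inl undefined"] ker_damping_zero_at_damped[OF damped that(2)] by simp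
    then show ?thesis by (simp add: vec_eq_iff)
  qed
  obtain \<beta> q0 where eq: "block_diag R *v (II *v \<beta>) + ?B *v (block_diag W *v q0) = v"
    using equilibrium_exists[OF Rp Wp span ker] by metis
  have eq': "transpose ?B *v (II *v \<beta>) = 0" by (rule transpose_BB_II[OF no_loop])
  show ?thesis
  proof
    assume ?no_eigenvector
    then have "(system_output M p \<longlongrightarrow> II *v \<beta>) at_top" if "trajectory tail head M R W v p q" for p q
      using trajectory_output_converges[OF Mp Rp Wp eq eq' _ that] by blast
    then show ?converges by (auto simp: im_def)
  next
    assume converges: ?converges
    show ?no_eigenvector
    proof (intro allI impI, rule ccontr)
      fix \<mu> x
      assume x: "laplacian tail head W *v x = \<mu> *\<^sub>R (block_diag M *v x)" "block_diag R *v x = 0" "x \<noteq> 0"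
      let ?Bx = "transpose ?B *v x"
      have "laplacian tail head W *v x = ?B *v (block_diag W *v ?Bx)"
        by (simp only: laplacian_def matrix_vector_mul_assoc matrix_mul_assoc)
      then have form: "\<mu> * (x \<bullet> (block_diag M *v x)) = ?Bx \<bullet> (block_diag W *v ?Bx)"
        using x(1) by (metis dot_lmul_matrix inner_scaleR_right transpose_matrix_vector)
      have "?Bx \<noteq> 0" using ker x by blast
      then have "0 < ?Bx \<bullet> (block_diag W *v ?Bx)" "0 < x \<bullet> (block_diag M *v x)"
        using Wp Mp x(3) unfolding posdef_def by blast+
      then have "\<mu> > 0" using form by (metis zero_less_mult_pos2)
      define \<omega> where "\<omega> = sqrt \<mu>"
      have \<omega>: "\<omega> > 0" "\<mu> = \<omega>\<^sup>2" using \<open>\<mu> > 0\<close> by (auto simp: \<omega>_def)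
      obtain p q where p: "trajectory tail head M R W v p q"
        "\<And>t. system_output M p t = II *v \<beta> + cos (\<omega> * t) *\<^sub>R x"
        using oscillating_trajectory[OF Mp eq eq' x(1)[unfolded \<omega>(2)] x(2)] \<omega>(1) by (metis less_irrefl)
      have "system_output M p = (\<lambda>t. II *v \<beta> + cos (\<omega> * t) *\<^sub>R x)" using p(2) by auto
      with converges p(1) oscillation_not_convergent[OF \<omega>(1) x(3)] show False by metis
    qed
  qed
qed

theorem mainTheorem4:
  fixes tail head :: "'e::finite \<Rightarrow> 'd::finite + 'u::finite"
    and M R :: "'d + 'u \<Rightarrow> real^'r::finite^'r"
    and W :: "'e \<Rightarrow> real^'r^'r"
    and v :: "real^(('d + 'u) \<times> 'r)"
  assumes "oriented_graph tail head"
    and "connected_graph tail head"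
    and "\<And>i. posdef (M i)"
    and "\<And>i. possemidef (R i)"
    and "\<And>k. posdef (W k)"
    and damped: "\<And>i. posdef (R (Inl i))"
    and undamped: "\<And>i. \<not> invertible (R (Inr i))"
  shows
    "((\<forall>p q. trajectory tail head M R W v p q \<longrightarrow>
          (\<exists>y\<in>im II. (system_output M p \<longlongrightarrow> y) at_top))
      \<longleftrightarrow>
      (\<forall>\<mu>\<in>spectrum (matrix_inv (block_u M) ** L_kron tail head W).
          ker (cmat (matrix_inv (block_u M) ** L_kron tail head W) - mat \<mu>)
            \<inter> ker (cmat (vstack (L_ii tail head W) (block_u R))) = {0}))
     \<and>
     ((\<forall>\<mu>\<in>spectrum (matrix_inv (block_u M) ** L_kron tail head W).
          ker (cmat (matrix_inv (block_u M) ** L_kron tail head W) - mat \<mu>)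
            \<inter> ker (cmat (vstack (L_ii tail head W) (block_u R))) = {0})
      \<longleftrightarrow>
      (\<forall>\<mu>\<in>spectrum (matrix_inv (block_diag M) ** laplacian tail head W).
          ker (cmat (matrix_inv (block_diag M) ** laplacian tail head W) - mat \<mu>)
            \<inter> ker (cmat (block_diag R))
            \<inter> im (cmat (vstack (0 :: real^('u \<times> 'r)^('d \<times> 'r)) (mat 1))) = {0}))"
proof -
  have Wsym: "transpose (block_diag (\<lambda>k. if k \<in> S then W k else 0)) = block_diag (\<lambda>k. if k \<in> S then W k else 0)" for S
  proof -
    have "transpose (if k \<in> S then W k else 0) = (if k \<in> S then W k else 0)" for k
      using assms(5)[of k] by (auto simp: posdef_def transpose_def vec_eq_iff)
    then show ?thesis by (simp add: transpose_block_diag)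
  qed
  have Lsym: "transpose (laplacian tail head W) = laplacian tail head W"
    unfolding laplacian_def using Wsym[of UNIV] by (intro weighted_gram_symmetric) simp
  have Lusym: "transpose (L_uu tail head W + L_ui tail head W) = L_uu tail head W + L_ui tail head W"
  proof -
    have "transpose (L_uu tail head W) = L_uu tail head W" "transpose (L_ui tail head W) = L_ui tail head W"
      unfolding L_uu_def L_ui_def W_on_def by (intro weighted_gram_symmetric Wsym)+
    then show ?thesis by (simp add: transpose_def vec_eq_iff)
  qed
  have Mu: "posdef (block_u M)" unfolding block_u_def by (intro posdef_block_diag assms(3))
  \<comment> \<open>the correction term of the Kron reduction acts through \<open>L_ii\<close>\<close>
  have agree: "L_kron tail head W *v z = (L_uu tail head W + L_ui tail head W) *v z"
    if "vstack (L_ii tail head W) (block_u R) *v z = 0" for z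
    using that unfolding vstack_mult_eq_0_iff L_kron_def
    by (simp add: matrix_vector_mult_diff_rdistrib flip: matrix_vector_mul_assoc)
  have kron_iff: "(\<forall>\<mu>\<in>spectrum (matrix_inv (block_u M) ** L_kron tail head W).
          ker (cmat (matrix_inv (block_u M) ** L_kron tail head W) - mat \<mu>)
            \<inter> ker (cmat (vstack (L_ii tail head W) (block_u R))) = {0}) \<longleftrightarrow>
      (\<forall>\<mu> z. (L_uu tail head W + L_ui tail head W) *v z = \<mu> *\<^sub>R (block_u M *v z)
            \<longrightarrow> vstack (L_ii tail head W) (block_u R) *v z = 0 \<longrightarrow> z = 0)"
    by (rule no_eigenvector_in_kernel_iff_real[OF Mu Lusym agree])
  have "ker (cmat (block_diag R)) \<subseteq> im (cmat (embed_u :: real^('u \<times> 'r)^(('d + 'u) \<times> 'r)))"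
  proof
    fix x assume "x \<in> ker (cmat (block_diag R))"
    moreover obtain a b where ab: "x = cvec a b" by (rule cvec_cases)
    ultimately have "block_diag R *v a = 0" "block_diag R *v b = 0"
      by (simp_all add: ker_def cmat_mult_cvec)
    then obtain a' b' where "a = embed_u *v a'" "b = embed_u *v b'"
      using ker_damping_in_range_embed_u[where R = R, OF damped] by metis
    then show "x \<in> im (cmat embed_u)"
      by (auto simp: ab im_def image_iff cmat_mult_cvec[symmetric])
  qed
  \<comment> \<open>so the third set in the intersection is implied by the second\<close>
  then have drop_im: "A \<inter> ker (cmat (block_diag R)) \<inter> im (cmat (vstack (0 :: real^('u \<times> 'r)^('d \<times> 'r)) (mat 1)))
      = A \<inter> ker (cmat (block_diag R))" for A
    unfolding embed_u_def by blast
  have laplacian_iff: "(\<forall>\<mu>\<in>spectrum (matrix_inv (block_diag M) ** laplacian tail head W).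
          ker (cmat (matrix_inv (block_diag M) ** laplacian tail head W) - mat \<mu>)
            \<inter> ker (cmat (block_diag R)) = {0}) \<longleftrightarrow>
      (\<forall>\<mu> x. laplacian tail head W *v x = \<mu> *\<^sub>R (block_diag M *v x)
            \<longrightarrow> block_diag R *v x = 0 \<longrightarrow> x = 0)"
    by (rule no_eigenvector_in_kernel_iff_real[OF posdef_block_diag[OF assms(3)] Lsym refl])
  show ?thesis
    unfolding drop_im laplacian_iff kron_iff undamped_eigenvectors_iff[where R = R, OF damped]
      convergence_iff_no_undamped_eigenvector[where R = R, OF assms(1-5) damped]
    by blast
qed

end
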